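(* There exists a real number $\boldsymbol s$ such that for almost all $\omega\in\Omega=[0,1)\times\{-1,1\}$ (with respect to the product of Lebesgue measure and counting measure), the Hausdorff dimension of the aperiodic set $\mathcal K_\omega$ is equal to $\boldsymbol s$.
   Context: For $\theta\in[0,1)$ let $\mathcal C=[0,1]^2$, $\mathcal R_\theta=[1,1+\theta]\times[0,1]$, $\mathcal X_\theta=\mathcal C\cup\mathcal R_\theta$ and $\mathcal D_\theta=\partial\mathcal C\cup\partial\mathcal R_\theta$. Let $\Omega=[0,1)\times\{-1,1\}$, $f_{-1}(x)=x$ and $f_1(x)=1-x$. For $\omega=(\theta,\epsilon)\in\Omega$ the map $T_\omega$ is defined on $\mathring{\mathcal C}\cup\mathring{\mathcal R}_\theta$ by $T_\omega(x,y)=(1+\theta-y,f_\epsilon(x))$ if $(x,y)\in\mathring{\mathcal C}$ and $T_\omega(x,y)=(x-1,1-y)$ if $(x,y)\in\mathring{\mathcal R}_\theta$. Put $\mathcal D_\omega=\bigcup_{k\ge0}T_\omega^{-k}(\mathcal D_\theta)$ and $\mathcal X_\omega=\mathcal X_\theta\setminus\mathcal D_\omega$ (the set of points whose whole forward orbit is defined). Coding: for $z\in\mathcal X_\omega$, $\Phi_\omega(z)=(u_n)_{n\ge0}\in\{a,b\}^{\mathbb N}$ with $u_n=a$ if $T_\omega^n(z)\in\mathcal C$ and $u_n=b$ if $T_\omega^n(z)\in\mathcal R_\theta$. For a finite word $u$, $\bar u=uuu\cdots$. A periodic cell is a nonempty set $\{z\in\mathcal X_\omega:\Phi_\omega(z)=\bar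 u\}$; its period is the period of the word $\bar u$. Let $\mathcal I_\omega(n)$ be the union of the periodic cells of period at most $n$, $\mathcal K_\omega(n)=\overline{\mathcal X_\omega\setminus\mathcal I_\omega(n)}$ (closure in $\mathbb R^2$), and $\mathcal K_\omega=\bigcap_{n\in\mathbb N}\mathcal K_\omega(n)$, the aperiodic set. *)

theory Defs
  imports "HOL-Analysis.Analysis"
begin

section \<open>Hausdorff measure and dimension\<close>

text \<open>The usual convention \<open>0\<^sup>0 = 1\<close> for nonempty sets makes the 0-dimensional measure the
  counting measure; \<open>powr\<close> alone would give \<open>0 powr 0 = 0\<close>. Empty members of a cover
  contribute nothing, so finite covers are included among the sequences of sets below.\<close>

definition diameter_pow :: "real \<Rightarrow> 'a::metric_space set \<Rightarrow> real" where
  "diameter_pow s U = (if U = {} then 0 else if s = 0 then 1 else diameter U powr s)"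

text \<open>Boundedness is required explicitly because \<open>diameter\<close> is an unspecified real number on
  unbounded sets.\<close>

definition hausdorff_premeasure :: "real \<Rightarrow> real \<Rightarrow> 'a::metric_space set \<Rightarrow> ennreal" where
  "hausdorff_premeasure s \<delta> A =
     (INF U \<in> {U :: nat \<Rightarrow> 'a set. A \<subseteq> (\<Union>i. U i) \<and> (\<forall>i. bounded (U i) \<and> diameter (U i) \<le> \<delta>)}.
        (\<Sum>i. ennreal (diameter_pow s (U i))))"

definition hausdorff_measure :: "real \<Rightarrow> 'a::metric_space set \<Rightarrow> ennreal" where
  "hausdorff_measure s A = (SUP \<delta> \<in> {0<..}. hausdorff_premeasure s \<delta> A)"

definition hausdorff_dim :: "'a::metric_space set \<Rightarrow> ereal" where
  "hausdorff_dim A = Inf {ereal s | s. 0 \<le> s \<and> hausdorff_measure s A = 0}"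

section \<open>The maps\<close>

type_synonym point = "real \<times> real"
type_synonym param = "real \<times> int"

definition sqC :: "point set" where
  "sqC = {0..1} \<times> {0..1}"

definition rectR :: "real \<Rightarrow> point set" where
  "rectR \<theta> = {1..1 + \<theta>} \<times> {0..1}"

definition spaceX :: "real \<Rightarrow> point set" where
  "spaceX \<theta> = sqC \<union> rectR \<theta>"

definition bdryD :: "real \<Rightarrow> point set" where
  "bdryD \<theta> = frontier sqC \<union> frontier (rectR \<theta>)"

definition Omega :: "param set" where
  "Omega = {0..<1} \<times> {-1, 1}"

definition Omega_measure :: "param measure" where
  "Omega_measure = restrict_space lborel {0..<1} \<Otimes>\<^sub>M count_space {-1, 1}"

lemma space_Omega_measure: "space Omega_measure = Omega"
  by (simp add: Omega_measure_def Omega_def space_pair_measure space_restrict_space)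

definition flip :: "int \<Rightarrow> real \<Rightarrow> real" where
  "flip \<epsilon> x = (if \<epsilon> = -1 then x else 1 - x)"

definition domT :: "param \<Rightarrow> point set" where
  "domT \<omega> = interior sqC \<union> interior (rectR (fst \<omega>))"

text \<open>The map is partial; its values are only used on \<open>domT\<close>.\<close>

definition mapT :: "param \<Rightarrow> point \<Rightarrow> point" where
  "mapT \<omega> z =
     (if z \<in> interior sqC then (1 + fst \<omega> - snd z, flip (snd \<omega>) (fst z))
      else if z \<in> interior (rectR (fst \<omega>)) then (fst z - 1, 1 - snd z)
      else undefined)"

definition preimT :: "param \<Rightarrow> point set \<Rightarrow> point set" where
  "preimT \<omega> S = {z \<in> domT \<omega>. mapT \<omega> z \<in> S}"

definition singD :: "param \<Rightarrow> point set" where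
  "singD \<omega> = (\<Union>k. (preimT \<omega> ^^ k) (bdryD (fst \<omega>)))"

definition regularX :: "param \<Rightarrow> point set" where
  "regularX \<omega> = spaceX (fst \<omega>) - singD \<omega>"

lemma regularX_dom:
  assumes "z \<in> regularX \<omega>"
  shows "z \<in> domT \<omega>"
proof -
  have "z \<notin> (preimT \<omega> ^^ 0) (bdryD (fst \<omega>))"
    using assms unfolding regularX_def singD_def by blast
  moreover have "closed sqC" "closed (rectR (fst \<omega>))"
    unfolding sqC_def rectR_def by (intro closed_Times closed_atLeastAtMost)+
  ultimately show ?thesis
    using assms unfolding regularX_def spaceX_def domT_def bdryD_def
    by (auto simp: frontier_def)
qed

section \<open>Coding, periodic cells and the aperiodic set\<close>

datatype letter = La | Lb

text \<open>On \<open>regularX\<close> every iterate lies in exactly one of the two open pieces, so the second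
  branch means that the iterate lies in \<open>rectR\<close>.\<close>

definition coding :: "param \<Rightarrow> point \<Rightarrow> nat \<Rightarrow> letter" where
  "coding \<omega> z = (\<lambda>n. if (mapT \<omega> ^^ n) z \<in> sqC then La else Lb)"

definition repeat_word :: "letter list \<Rightarrow> nat \<Rightarrow> letter" where
  "repeat_word u = (\<lambda>n. u ! (n mod length u))"

definition word_period :: "(nat \<Rightarrow> letter) \<Rightarrow> nat" where
  "word_period w = (LEAST p. 0 < p \<and> (\<forall>n. w (n + p) = w n))"

definition cell :: "param \<Rightarrow> (nat \<Rightarrow> letter) \<Rightarrow> point set" where
  "cell \<omega> w = {z \<in> regularX \<omega>. coding \<omega> z = w}"

definition periodicI :: "param \<Rightarrow> nat \<Rightarrow> point set" where
  "periodicI \<omega> n =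
     \<Union> {cell \<omega> (repeat_word u) | u.
          u \<noteq> [] \<and> cell \<omega> (repeat_word u) \<noteq> {} \<and> word_period (repeat_word u) \<le> n}"

definition setK :: "param \<Rightarrow> nat \<Rightarrow> point set" where
  "setK \<omega> n = closure (regularX \<omega> - periodicI \<omega> n)"

definition aperiodicK :: "param \<Rightarrow> point set" where
  "aperiodicK \<omega> = (\<Inter>n. setK \<omega> n)"

lemma regularX_invariant:
  assumes \<omega>: "\<omega> \<in> Omega" and z: "z \<in> regularX \<omega>"
  shows "mapT \<omega> z \<in> regularX \<omega>"
proof -
  have dom: "z \<in> domT \<omega>" by (rule regularX_dom[OF z])
  have "mapT \<omega> z \<notin> (preimT \<omega> ^^ k) (bdryD (fst \<omega>))" for k
  proof
    assume "mapT \<omega> z \<in> (preimT \<omega> ^^ k) (bdryD (fst \<omega>))"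
    hence "z \<in> (preimT \<omega> ^^ Suc k) (bdryD (fst \<omega>))"
      using dom by (simp add: preimT_def)
    thus False using z unfolding regularX_def singD_def by blast
  qed
  moreover have "mapT \<omega> z \<in> spaceX (fst \<omega>)"
    using dom \<omega> by (auto simp: mapT_def domT_def spaceX_def sqC_def rectR_def flip_def
      interior_Times Omega_def)
  ultimately show ?thesis unfolding regularX_def singD_def by blast
qed

end

theory Submission
  imports Defs
begin

text \<open>For all \<open>\<theta> > 0\<close> the following changes of parameter preserve the dimension of the aperiodic set,
  because a first-return-type induced map of one system is similar to the other system and the remaining
  points are covered by finitely many isometric images of the induced domain or have period at most 8:
  \<open>(\<theta>, -1) \<rightarrow> (1/\<theta> - 1, 1)\<close> for \<open>\<theta> < 1\<close>, \<open>(\<theta>, 1) \<rightarrow> (\<theta>/(1 - \<theta>), 1)\<close> for \<open>\<theta> < 1\<close>, and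
  \<open>(\<theta>, \<epsilon>) \<rightarrow> (\<theta> - 1, -\<epsilon>)\<close> for \<open>\<theta> > 1\<close>. Accelerated, they form an extension of the Gauss map with three
  states on which the dynamics is transitive. The parameters for which the \<open>s\<close>-dimensional Hausdorff
  measure of the aperiodic set vanishes form an invariant set, which is Borel because a nonperiodic orbit
  segment survives small changes of point and parameter. Ergodicity of the extension then makes the set null
  or conull.\<close>

section \<open>Generic points and the dynamics\<close>

text \<open>The obstacle is that T is partial and that the aperiodic set is an intersection of
  closures of sets cut out by codes. Both difficulties go away on points neither of whose
  coordinates lies in Z + \<theta> Z: they never meet a discontinuity, every renormalization matches
  them with points of the same kind, and on them periodicity of codes may be replaced by periodicity
  of points, at the cost of a factor 4 in the period that disappears in the intersection. The third
  state is forced by the sign 1. There the renormalization lowers 1/\<theta> by 1, so it strips the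
  whole first partial quotient and overshoots to (1/t, 1) with 1/t > 1. One subtraction leads to
  (1/t - 1, -1), which is not of the form (t, 1) or (t, -1) and has to be remembered until the next
  partial quotient is read. The dimension is reached one exponent at a time: the zero-one law
  decides each s > 0 separately, and the common dimension is the infimum of the exponents for which
  nullity holds almost surely.\<close>

definition lattice :: "real \<Rightarrow> real set" where
  "lattice \<theta> = {of_int a + of_int b * \<theta> | a b :: int. True}"

lemma countable_lattice: "countable (lattice \<theta>)"
proof -
  have "lattice \<theta> = (\<lambda>(a::int, b::int). of_int a + of_int b * \<theta>) ` UNIV"
    by (auto simp: lattice_def image_def)
  then show ?thesis by simp
qed

lemma lattice_0 [simp]: "0 \<in> lattice \<theta>" and lattice_1 [simp]: "1 \<in> lattice \<theta>"
  and lattice_self [simp]: "\<theta> \<in> lattice \<theta>"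
proof -
  have "0 = of_int 0 + of_int 0 * \<theta>" "1 = of_int 1 + of_int 0 * \<theta>" "\<theta> = of_int 0 + of_int 1 * \<theta>"
    by simp_all
  then show "0 \<in> lattice \<theta>" "1 \<in> lattice \<theta>" "\<theta> \<in> lattice \<theta>"
    unfolding lattice_def by blast+
qed

lemma lattice_add:
  assumes "x \<in> lattice \<theta>" "y \<in> lattice \<theta>"
  shows "x + y \<in> lattice \<theta>"
proof -
  obtain a b c d where "x = of_int a + of_int b * \<theta>" "y = of_int c + of_int d * \<theta>"
    using assms unfolding lattice_def by blast
  then have "x + y = of_int (a + c) + of_int (b + d) * \<theta>" by (simp add: algebra_simps)
  then show ?thesis unfolding lattice_def by blast
qed

lemma lattice_minus:
  assumes "x \<in> lattice \<theta>"
  shows "- x \<in> lattice \<theta>"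
proof -
  obtain a b where "x = of_int a + of_int b * \<theta>"
    using assms unfolding lattice_def by blast
  then have "- x = of_int (- a) + of_int (- b) * \<theta>" by (simp add: algebra_simps)
  then show ?thesis unfolding lattice_def by blast
qed

lemma lattice_diff: "x \<in> lattice \<theta> \<Longrightarrow> y \<in> lattice \<theta> \<Longrightarrow> x - y \<in> lattice \<theta>"
  using lattice_add[of x \<theta> "- y"] lattice_minus[of y \<theta>] by simp

lemma lattice_add_iff [simp]:
  assumes "c \<in> lattice \<theta>"
  shows "c + x \<in> lattice \<theta> \<longleftrightarrow> x \<in> lattice \<theta>" "x + c \<in> lattice \<theta> \<longleftrightarrow> x \<in> lattice \<theta>"
    "c - x \<in> lattice \<theta> \<longleftrightarrow> x \<in> lattice \<theta>" "x - c \<in> lattice \<theta> \<longleftrightarrow> x \<in> lattice \<theta>"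
proof -
  have 1: "c + x \<in> lattice \<theta> \<longleftrightarrow> x \<in> lattice \<theta>" for x
    using lattice_diff[of "c + x" \<theta> c] lattice_add[of c \<theta> x] assms by auto
  have 2: "x - c \<in> lattice \<theta> \<longleftrightarrow> x \<in> lattice \<theta>"
    using 1[of "x - c"] by simp
  have 3: "c - x \<in> lattice \<theta> \<longleftrightarrow> x \<in> lattice \<theta>"
    using 1[of "- x"] lattice_minus[of x \<theta>] lattice_minus[of "- x" \<theta>] by auto
  show "c + x \<in> lattice \<theta> \<longleftrightarrow> x \<in> lattice \<theta>" "x + c \<in> lattice \<theta> \<longleftrightarrow> x \<in> lattice \<theta>"
    "c - x \<in> lattice \<theta> \<longleftrightarrow> x \<in> lattice \<theta>" "x - c \<in> lattice \<theta> \<longleftrightarrow> x \<in> lattice \<theta>"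
    using 1 2 3 by (simp_all add: add.commute[of _ c])
qed

lemma lattice_1_add_self [simp]: "1 + \<theta> \<in> lattice \<theta>" by simp

section \<open>Points whose orbits avoid the discontinuities\<close>

definition generic :: "real \<Rightarrow> point set" where
  "generic \<theta> = {z. 0 < fst z \<and> fst z < 1 + \<theta> \<and> 0 < snd z \<and> snd z < 1
     \<and> fst z \<notin> lattice \<theta> \<and> snd z \<notin> lattice \<theta>}"

lemma genericD:
  assumes "(x, y) \<in> generic \<theta>"
  shows "0 < x" "x < 1 + \<theta>" "0 < y" "y < 1" "x \<notin> lattice \<theta>" "y \<notin> lattice \<theta>"
    "x \<noteq> 1" "x \<noteq> \<theta>" "y \<noteq> \<theta>" "y \<noteq> 1 - \<theta>"
proof -
  show "0 < x" "x < 1 + \<theta>" "0 < y" "y < 1" and l: "x \<notin> lattice \<theta>" "y \<notin> lattice \<theta>"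
    using assms by (auto simp: generic_def)
  show "x \<noteq> 1" "x \<noteq> \<theta>" "y \<noteq> \<theta>" "y \<noteq> 1 - \<theta>"
    using l by auto
qed

lemma flip_lattice [simp]: "flip \<epsilon> x \<in> lattice \<theta> \<longleftrightarrow> x \<in> lattice \<theta>"
  by (simp add: flip_def)

lemma flip_flip [simp]: "flip \<epsilon> (flip \<epsilon> x) = x"
  by (simp add: flip_def)

lemma flip_pos_iff: "0 < x \<Longrightarrow> x < 1 \<Longrightarrow> 0 < flip \<epsilon> x" "0 < x \<Longrightarrow> x < 1 \<Longrightarrow> flip \<epsilon> x < 1"
  by (auto simp: flip_def)

lemma interior_sqC: "interior sqC = {0<..<1} \<times> {0<..<1}"
  by (simp add: sqC_def interior_Times)

lemma interior_rectR: "interior (rectR \<theta>) = {1<..<1 + \<theta>} \<times> {0<..<1}"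
  by (simp add: rectR_def interior_Times)

lemma mapT_C: "0 < x \<Longrightarrow> x < 1 \<Longrightarrow> 0 < y \<Longrightarrow> y < 1 \<Longrightarrow> mapT (\<theta>, \<epsilon>) (x, y) = (1 + \<theta> - y, flip \<epsilon> x)"
  by (simp add: mapT_def interior_sqC)

lemma mapT_R: "1 < x \<Longrightarrow> x < 1 + \<theta> \<Longrightarrow> 0 < y \<Longrightarrow> y < 1 \<Longrightarrow> mapT (\<theta>, \<epsilon>) (x, y) = (x - 1, 1 - y)"
  by (simp add: mapT_def interior_sqC interior_rectR)

lemma mapT_generic:
  assumes "\<theta> > 0" "z \<in> generic \<theta>"
  shows "mapT (\<theta>, \<epsilon>) z \<in> generic \<theta>"
proof (cases z)
  case (Pair x y)
  note g = genericD[OF assms(2)[unfolded Pair]]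
  show ?thesis
  proof (cases "x < 1")
    case True
    then show ?thesis using g assms(1) unfolding Pair
      by (subst mapT_C) (auto simp: generic_def flip_pos_iff)
  next
    case False
    then have "x > 1" using g by auto
    then show ?thesis using g assms(1) unfolding Pair
      by (subst mapT_R) (auto simp: generic_def)
  qed
qed

lemma mapT_pow_generic:
  "\<theta> > 0 \<Longrightarrow> z \<in> generic \<theta> \<Longrightarrow> (mapT (\<theta>, \<epsilon>) ^^ n) z \<in> generic \<theta>"
  by (induction n) (auto intro: mapT_generic)

text \<open>The first coordinate of the image tells which piece the point came from: it exceeds
  \<theta> after the square and is below \<theta> after the rectangle. Each branch by itself is an
  isometry.\<close>

lemma inj_on_mapT_generic:
  assumes "\<theta> > 0"
  shows "inj_on (mapT (\<theta>, \<epsilon>)) (generic \<theta>)"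
proof (rule inj_onI)
  fix z w assume zw: "z \<in> generic \<theta>" "w \<in> generic \<theta>" and eq: "mapT (\<theta>, \<epsilon>) z = mapT (\<theta>, \<epsilon>) w"
  obtain x y x' y' where p: "z = (x, y)" "w = (x', y')" by (metis surj_pair)
  note g = genericD[OF zw(1)[unfolded p]] genericD[OF zw(2)[unfolded p]]
  consider "x < 1" "x' < 1" | "x < 1" "x' > 1" | "x > 1" "x' < 1" | "x > 1" "x' > 1"
    using g by linarith
  then show "z = w"
    using eq g assms unfolding p
    by cases (auto simp: mapT_C mapT_R flip_def split: if_splits)
qed

lemma inj_on_mapT_pow_generic:
  assumes "\<theta> > 0"
  shows "inj_on (mapT (\<theta>, \<epsilon>) ^^ n) (generic \<theta>)"
proof (induction n)
  case (Suc n)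
  have "inj_on (mapT (\<theta>, \<epsilon>)) ((mapT (\<theta>, \<epsilon>) ^^ n) ` generic \<theta>)"
    by (rule inj_on_subset[OF inj_on_mapT_generic[OF assms]]) (use mapT_pow_generic[OF assms] in blast)
  from comp_inj_on[OF Suc this] show ?case by (simp add: comp_def)
qed simp

lemma generic_dense:
  assumes "0 < fst z" "fst z < 1 + \<theta>" "0 < snd z" "snd z < 1" "open U" "z \<in> U"
  obtains w where "w \<in> U" "w \<in> generic \<theta>"
proof -
  define V where "V = U \<inter> ({0<..<1 + \<theta>} \<times> {0<..<1})"
  have "open V" "z \<in> V"
    using assms by (auto simp: V_def mem_Times_iff intro!: open_Int open_Times)
  then obtain A B where AB: "open A" "open B" "z \<in> A \<times> B" "A \<times> B \<subseteq> V"
    by (rule open_prod_elim)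
  have "\<exists>x\<in>A. x \<notin> lattice \<theta>" if "open A" "a \<in> A" for A and a :: real
    using open_minus_countable[OF countable_lattice _ that(1)] that(2) by blast
  then obtain x y where "x \<in> A" "x \<notin> lattice \<theta>" "y \<in> B" "y \<notin> lattice \<theta>"
    using AB by (metis mem_Times_iff)
  then have "(x, y) \<in> V" using AB by blast
  then show ?thesis
    using that[of "(x, y)"] \<open>x \<notin> _\<close> \<open>y \<notin> _\<close> by (auto simp: V_def generic_def)
qed

text \<open>The boundary consists of horizontal and vertical segments with lattice coordinates. The
  map only exchanges the coordinates, changes signs and adds lattice elements, so every preimage of
  such a segment again has a lattice coordinate.\<close>

lemma singD_lattice:
  assumes "z \<in> singD (\<theta>, \<epsilon>)"
  shows "fst z \<in> lattice \<theta> \<or> snd z \<in> lattice \<theta>"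
proof -
  have "fst z \<in> lattice \<theta> \<or> snd z \<in> lattice \<theta>" if "z \<in> (preimT (\<theta>, \<epsilon>) ^^ k) (bdryD \<theta>)" for k z
    using that
  proof (induction k arbitrary: z)
    case 0
    then have z: "z \<in> bdryD \<theta>" by simp
    have "closed sqC" "closed (rectR \<theta>)"
      unfolding sqC_def rectR_def by (intro closed_Times closed_atLeastAtMost)+
    then have "z \<in> sqC - interior sqC \<or> z \<in> rectR \<theta> - interior (rectR \<theta>)"
      using z by (auto simp: bdryD_def frontier_def)
    then have "fst z \<in> {0, 1, 1 + \<theta>} \<or> snd z \<in> {0, 1}"
      unfolding interior_sqC interior_rectR
      by (auto simp: sqC_def rectR_def mem_Times_iff)
    then show ?case by auto
  next
    case (Suc k)
    then have d: "z \<in> domT (\<theta>, \<epsilon>)" and m: "mapT (\<theta>, \<epsilon>) z \<in> (preimT (\<theta>, \<epsilon>) ^^ k) (bdryD \<theta>)"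
      by (simp_all add: preimT_def[of _ "(preimT (\<theta>, \<epsilon>) ^^ k) (bdryD \<theta>)"])
    show ?case
      using Suc.IH[OF m] d
      by (auto simp: domT_def mapT_def split: if_splits)
  qed
  moreover obtain k where "z \<in> (preimT (\<theta>, \<epsilon>) ^^ k) (bdryD \<theta>)"
    using assms unfolding singD_def by auto
  ultimately show ?thesis by blast
qed

lemma generic_regular: "\<theta> > 0 \<Longrightarrow> generic \<theta> \<subseteq> regularX (\<theta>, \<epsilon>)"
  using singD_lattice by (fastforce simp: regularX_def generic_def spaceX_def sqC_def rectR_def mem_Times_iff)

lemma mapT_regular:
  assumes z: "z \<in> regularX (\<theta>, \<epsilon>)" and "\<theta> > 0"
  shows "mapT (\<theta>, \<epsilon>) z \<in> regularX (\<theta>, \<epsilon>)"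
proof -
  have dom: "z \<in> domT (\<theta>, \<epsilon>)" by (rule regularX_dom[OF z])
  have "mapT (\<theta>, \<epsilon>) z \<notin> (preimT (\<theta>, \<epsilon>) ^^ k) (bdryD \<theta>)" for k
  proof
    assume "mapT (\<theta>, \<epsilon>) z \<in> (preimT (\<theta>, \<epsilon>) ^^ k) (bdryD \<theta>)"
    then have "z \<in> (preimT (\<theta>, \<epsilon>) ^^ Suc k) (bdryD \<theta>)"
      using dom by (simp add: preimT_def)
    then show False using z unfolding regularX_def singD_def by (metis DiffE UN_I UNIV_I fst_conv)
  qed
  moreover have "mapT (\<theta>, \<epsilon>) z \<in> spaceX \<theta>"
    using dom \<open>\<theta> > 0\<close> by (auto simp: mapT_def domT_def spaceX_def sqC_def rectR_def flip_def interior_Times)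
  ultimately show ?thesis unfolding regularX_def singD_def by auto
qed

lemma mapT_pow_regular:
  "z \<in> regularX (\<theta>, \<epsilon>) \<Longrightarrow> \<theta> > 0 \<Longrightarrow> (mapT (\<theta>, \<epsilon>) ^^ n) z \<in> regularX (\<theta>, \<epsilon>)"
  by (induction n) (auto intro: mapT_regular)

section \<open>Joint continuity in the parameter and the point\<close>

lemma isCont_mapT_joint:
  assumes "z \<in> domT (\<theta>, \<epsilon>)"
  shows "isCont (\<lambda>p. mapT (fst p, \<epsilon>) (snd p)) (\<theta>, z)"
proof -
  consider "z \<in> interior sqC" | "z \<in> interior (rectR \<theta>)" "z \<notin> interior sqC"
    using assms by (auto simp: domT_def)
  then show ?thesis
  proof cases
    case 1
    have "eventually (\<lambda>p. p \<in> UNIV \<times> interior sqC) (nhds (\<theta>, z))"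
      by (rule eventually_nhds_in_open) (use 1 in \<open>auto intro!: open_Times\<close>)
    then have "eventually (\<lambda>p. mapT (fst p, \<epsilon>) (snd p) =
        (1 + fst p - snd (snd p), if \<epsilon> = -1 then fst (snd p) else 1 - fst (snd p))) (nhds (\<theta>, z))"
      by eventually_elim (auto simp: mapT_def flip_def)
    moreover have "isCont (\<lambda>p::real \<times> point. (1 + fst p - snd (snd p), if \<epsilon> = -1 then fst (snd p) else 1 - fst (snd p))) (\<theta>, z)"
      by (cases "\<epsilon> = -1") (simp_all add: continuous_intros)
    ultimately show ?thesis by (subst isCont_cong) auto
  next
    case 2
    define O' where "O' = {p::real \<times> point. 1 < fst (snd p) \<and> fst (snd p) < 1 + fst p
      \<and> 0 < snd (snd p) \<and> snd (snd p) < 1}"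
    have "open O'" unfolding O'_def
      by (intro open_Collect_conj open_Collect_less continuous_intros)
    moreover have "(\<theta>, z) \<in> O'" using 2 by (auto simp: O'_def interior_rectR mem_Times_iff)
    ultimately have "eventually (\<lambda>p. p \<in> O') (nhds (\<theta>, z))" by (rule eventually_nhds_in_open)
    then have "eventually (\<lambda>p. mapT (fst p, \<epsilon>) (snd p) = (fst (snd p) - 1, 1 - snd (snd p))) (nhds (\<theta>, z))"
    proof eventually_elim
      case (elim p)
      then show ?case by (auto simp: mapT_def O'_def interior_sqC interior_rectR mem_Times_iff)
    qed
    moreover have "isCont (\<lambda>p::real \<times> point. (fst (snd p) - 1, 1 - snd (snd p))) (\<theta>, z)"
      by (intro continuous_intros)
    ultimately show ?thesis by (subst isCont_cong) auto
  qed
qed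

lemma isCont_mapT_pow_joint:
  assumes "z \<in> regularX (\<theta>, \<epsilon>)" "\<theta> > 0"
  shows "isCont (\<lambda>p. (mapT (fst p, \<epsilon>) ^^ n) (snd p)) (\<theta>, z)"
proof (induction n)
  case 0
  show ?case by (simp add: continuous_snd)
next
  case (Suc n)
  have dom: "(mapT (\<theta>, \<epsilon>) ^^ n) z \<in> domT (\<theta>, \<epsilon>)"
    by (intro regularX_dom mapT_pow_regular assms)
  have "isCont (\<lambda>p. (fst p, (mapT (fst p, \<epsilon>) ^^ n) (snd p))) (\<theta>, z)"
    by (intro continuous_intros Suc)
  from isCont_o2[OF this, of "\<lambda>p. mapT (fst p, \<epsilon>) (snd p)"] isCont_mapT_joint[OF dom]
  show ?case by simp
qed

definition nonper :: "param \<Rightarrow> nat \<Rightarrow> point set" where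
  "nonper \<omega> n = {z \<in> generic (fst \<omega>). \<forall>q\<in>{1..n}. (mapT \<omega> ^^ q) z \<noteq> z}"

lemma nonper_antimono: "m \<le> n \<Longrightarrow> nonper \<omega> n \<subseteq> nonper \<omega> m"
  by (auto simp: nonper_def)

lemma eventually_nonper:
  assumes z: "z \<in> regularX (\<theta>, \<epsilon>)" and "\<theta> > 0" and n: "\<forall>q\<in>{1..n}. (mapT (\<theta>, \<epsilon>) ^^ q) z \<noteq> z"
  shows "eventually (\<lambda>p. 0 < fst (snd p) \<and> fst (snd p) < 1 + fst p \<and> 0 < snd (snd p) \<and> snd (snd p) < 1
    \<and> (\<forall>q\<in>{1..n}. (mapT (fst p, \<epsilon>) ^^ q) (snd p) \<noteq> snd p)) (nhds (\<theta>, z))"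
proof -
  define O' where "O' = {p::real \<times> point. 0 < fst (snd p) \<and> fst (snd p) < 1 + fst p
      \<and> 0 < snd (snd p) \<and> snd (snd p) < 1}"
  have "open O'" unfolding O'_def
    by (intro open_Collect_conj open_Collect_less continuous_intros)
  moreover have "(\<theta>, z) \<in> O'" using regularX_dom[OF z] \<open>\<theta> > 0\<close>
    by (auto simp: O'_def domT_def interior_sqC interior_rectR mem_Times_iff)
  ultimately have 1: "eventually (\<lambda>p. p \<in> O') (nhds (\<theta>, z))" by (rule eventually_nhds_in_open)
  have "eventually (\<lambda>p. (mapT (fst p, \<epsilon>) ^^ q) (snd p) \<noteq> snd p) (nhds (\<theta>, z))" if "q \<in> {1..n}" for q
  proof -
    have "isCont (\<lambda>p. (mapT (fst p, \<epsilon>) ^^ q) (snd p) - snd p) (\<theta>, z)"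
      by (intro continuous_intros isCont_mapT_pow_joint z \<open>\<theta> > 0\<close>)
    then have t: "((\<lambda>p. (mapT (fst p, \<epsilon>) ^^ q) (snd p) - snd p) \<longlongrightarrow> (mapT (\<theta>, \<epsilon>) ^^ q) z - z) (nhds (\<theta>, z))"
      using tendsto_at_iff_tendsto_nhds[of "\<lambda>p. (mapT (fst p, \<epsilon>) ^^ q) (snd p) - snd p" "(\<theta>, z)"]
      by (simp add: isCont_def)
    have ne: "(mapT (\<theta>, \<epsilon>) ^^ q) z - z \<noteq> 0" using n that by auto
    have "eventually (\<lambda>p. (mapT (fst p, \<epsilon>) ^^ q) (snd p) - snd p \<noteq> 0) (nhds (\<theta>, z))"
      by (rule tendsto_imp_eventually_ne[OF t ne])
    then show ?thesis by eventually_elim auto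
  qed
  then have 2: "eventually (\<lambda>p. \<forall>q\<in>{1..n}. (mapT (fst p, \<epsilon>) ^^ q) (snd p) \<noteq> snd p) (nhds (\<theta>, z))"
    by (auto intro!: eventually_ball_finite)
  show ?thesis using 1 2 by eventually_elim (auto simp: O'_def)
qed

section \<open>Periodic codings\<close>

text \<open>These are the isometries of the plane whose linear part is a symmetry of the square,
  that is, a signed permutation matrix. Both branches of T have this form.\<close>

definition quarter_map :: "(point \<Rightarrow> point) \<Rightarrow> bool" where
  "quarter_map g \<longleftrightarrow> (\<exists>s t c d. s \<in> {-1, 1} \<and> t \<in> {-1, 1} \<and>
     (g = (\<lambda>z. (s * fst z + c, t * snd z + d)) \<or> g = (\<lambda>z. (s * snd z + c, t * fst z + d))))"

lemma quarter_map_id: "quarter_map id"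
  unfolding quarter_map_def by (intro exI[of _ 1] exI[of _ 0]) (auto simp: id_def)

lemma quarter_mapI1:
  "s \<in> {-1, 1} \<Longrightarrow> t \<in> {-1, 1} \<Longrightarrow> (\<And>z. g z = (s * fst z + c, t * snd z + d)) \<Longrightarrow> quarter_map g"
  unfolding quarter_map_def by blast

lemma quarter_mapI2:
  "s \<in> {-1, 1} \<Longrightarrow> t \<in> {-1, 1} \<Longrightarrow> (\<And>z. g z = (s * snd z + c, t * fst z + d)) \<Longrightarrow> quarter_map g"
  unfolding quarter_map_def by blast

lemma quarter_map_comp:
  assumes "quarter_map g" "quarter_map h"
  shows "quarter_map (g \<circ> h)"
proof -
  obtain s t c d where g: "s \<in> {-1, 1}" "t \<in> {-1, 1}"
    "g = (\<lambda>z. (s * fst z + c, t * snd z + d)) \<or> g = (\<lambda>z. (s * snd z + c, t * fst z + d))"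
    using assms(1) unfolding quarter_map_def by blast
  obtain s' t' c' d' where h: "s' \<in> {-1, 1}" "t' \<in> {-1, 1}"
    "h = (\<lambda>z. (s' * fst z + c', t' * snd z + d')) \<or> h = (\<lambda>z. (s' * snd z + c', t' * fst z + d'))"
    using assms(2) unfolding quarter_map_def by blast
  from g(3) show ?thesis
  proof
    assume g': "g = (\<lambda>z. (s * fst z + c, t * snd z + d))"
    from h(3) show ?thesis
    proof
      assume "h = (\<lambda>z. (s' * fst z + c', t' * snd z + d'))"
      then show ?thesis using g h g'
        by (intro quarter_mapI1[of "s * s'" "t * t'" _ "s * c' + c" "t * d' + d"]) (auto simp: algebra_simps)
    next
      assume "h = (\<lambda>z. (s' * snd z + c', t' * fst z + d'))"
      then show ?thesis using g h g'
        by (intro quarter_mapI2[of "s * s'" "t * t'" _ "s * c' + c" "t * d' + d"]) (auto simp: algebra_simps)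
    qed
  next
    assume g': "g = (\<lambda>z. (s * snd z + c, t * fst z + d))"
    from h(3) show ?thesis
    proof
      assume "h = (\<lambda>z. (s' * fst z + c', t' * snd z + d'))"
      then show ?thesis using g h g'
        by (intro quarter_mapI2[of "s * t'" "t * s'" _ "s * d' + c" "t * c' + d"]) (auto simp: algebra_simps)
    next
      assume "h = (\<lambda>z. (s' * snd z + c', t' * fst z + d'))"
      then show ?thesis using g h g'
        by (intro quarter_mapI1[of "s * t'" "t * s'" _ "s * d' + c" "t * c' + d"]) (auto simp: algebra_simps)
    qed
  qed
qed

text \<open>The symmetry group of the square has exponent 4, so the linear part of the fourth power
  is the identity; the translation vector is read off at the origin.\<close>

lemma quarter_map_pow4:
  assumes "quarter_map g"
  obtains v where "\<And>z. (g ^^ 4) z = z + v"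
proof -
  obtain s t c d where g: "s \<in> {-1, 1}" "t \<in> {-1, 1}"
    "g = (\<lambda>z. (s * fst z + c, t * snd z + d)) \<or> g = (\<lambda>z. (s * snd z + c, t * fst z + d))"
    using assms unfolding quarter_map_def by blast
  have "\<exists>v. \<forall>z. (g ^^ 4) z = z + v"
    using g(3)
  proof
    assume "g = (\<lambda>z. (s * fst z + c, t * snd z + d))"
    then show ?thesis using g(1,2)
      by (intro exI[of _ "(g ^^ 4) 0"]) (auto simp: eval_nat_numeral)
  next
    assume "g = (\<lambda>z. (s * snd z + c, t * fst z + d))"
    then show ?thesis using g(1,2)
      by (intro exI[of _ "(g ^^ 4) 0"]) (auto simp: eval_nat_numeral)
  qed
  then show ?thesis using that by blast
qed

text \<open>The two branches of T, extended to total affine maps of the plane so that they can be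
  composed along a code.\<close>

definition piece_map :: "param \<Rightarrow> letter \<Rightarrow> point \<Rightarrow> point" where
  "piece_map \<omega> l z = (case l of La \<Rightarrow> (1 + fst \<omega> - snd z, flip (snd \<omega>) (fst z)) | Lb \<Rightarrow> (fst z - 1, 1 - snd z))"

lemma quarter_map_piece_map: "quarter_map (piece_map \<omega> l)"
proof (cases l)
  case La
  show ?thesis
    by (rule quarter_mapI2[of "-1" "if snd \<omega> = -1 then 1 else -1" _ "1 + fst \<omega>" "if snd \<omega> = -1 then 0 else 1"])
      (auto simp: piece_map_def La flip_def)
next
  case Lb
  show ?thesis
    by (rule quarter_mapI1[of 1 "-1" _ "-1" "1"]) (auto simp: piece_map_def Lb)
qed

lemma mapT_eq_piece_map:
  assumes "z \<in> regularX \<omega>"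
  shows "mapT \<omega> z = piece_map \<omega> (coding \<omega> z 0) z"
proof -
  have "z \<in> {0<..<1} \<times> {0<..<1} \<or> z \<in> {1<..<1 + fst \<omega>} \<times> {0<..<1}"
    using regularX_dom[OF assms] by (simp add: domT_def interior_sqC interior_rectR)
  then show ?thesis
    unfolding mapT_def piece_map_def coding_def interior_sqC interior_rectR
    by (auto simp: sqC_def)
qed

lemma coding_shift: "coding \<omega> ((mapT \<omega> ^^ n) z) m = coding \<omega> z (n + m)"
proof -
  have "(mapT \<omega> ^^ m) ((mapT \<omega> ^^ n) z) = (mapT \<omega> ^^ (n + m)) z"
    by (metis add.commute comp_apply funpow_add)
  then show ?thesis by (simp only: coding_def)
qed

text \<open>The return map along a periodic code has linear part in the dihedral group of order 8,
  so its fourth power is a translation, which must be trivial since orbits are bounded.\<close>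

lemma periodic_coding_imp_periodic:
  assumes z: "z \<in> regularX (\<theta>, \<epsilon>)" and "\<theta> > 0"
    and per: "\<And>n. coding (\<theta>, \<epsilon>) z (n + p) = coding (\<theta>, \<epsilon>) z n"
  shows "(mapT (\<theta>, \<epsilon>) ^^ (4 * p)) z = z"
proof -
  let ?T = "mapT (\<theta>, \<epsilon>)"
  \<comment> \<open>\<open>G n\<close> composes the branches along the first n letters of the code
    of z. Every regular point with the same code follows it, in particular the points
    \<open>(?T ^^ (k * p)) z\<close>, which yields powers of the single map
    \<open>G p\<close>.\<close>
  define G where "G = rec_nat id (\<lambda>n g. piece_map (\<theta>, \<epsilon>) (coding (\<theta>, \<epsilon>) z n) \<circ> g)"
  have G0: "G 0 = id" and GS: "\<And>n. G (Suc n) = piece_map (\<theta>, \<epsilon>) (coding (\<theta>, \<epsilon>) z n) \<circ> G n"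
    by (simp_all add: G_def)
  have qG: "quarter_map (G n)" for n
    by (induction n) (simp_all only: G0 GS quarter_map_id quarter_map_comp quarter_map_piece_map)
  have step: "(?T ^^ n) w = G n w" if "w \<in> regularX (\<theta>, \<epsilon>)" "coding (\<theta>, \<epsilon>) w = coding (\<theta>, \<epsilon>) z" for n w
  proof (induction n)
    case (Suc n)
    have "?T ((?T ^^ n) w) = piece_map (\<theta>, \<epsilon>) (coding (\<theta>, \<epsilon>) ((?T ^^ n) w) 0) ((?T ^^ n) w)"
      by (rule mapT_eq_piece_map) (rule mapT_pow_regular[OF that(1) \<open>\<theta> > 0\<close>])
    moreover have "coding (\<theta>, \<epsilon>) ((?T ^^ n) w) 0 = coding (\<theta>, \<epsilon>) z n"
      using coding_shift[of "(\<theta>, \<epsilon>)" n w 0] that(2) by simp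
    ultimately show ?case using Suc by (simp add: GS)
  qed (simp add: G0)
  have perk: "coding (\<theta>, \<epsilon>) z (n + k * p) = coding (\<theta>, \<epsilon>) z n" for n k
  proof (induction k)
    case (Suc k)
    then show ?case using per[of "n + k * p"] by (simp add: add.assoc add.commute[of p])
  qed simp
  have cod: "coding (\<theta>, \<epsilon>) ((?T ^^ (k * p)) z) = coding (\<theta>, \<epsilon>) z" for k
    using perk by (auto simp: coding_shift add.commute)
  have iter: "(?T ^^ (k * p)) z = (G p ^^ k) z" for k
  proof (induction k)
    case (Suc k)
    have "(?T ^^ (Suc k * p)) z = (?T ^^ p) ((?T ^^ (k * p)) z)"
      by (simp add: funpow_add)
    also have "\<dots> = G p ((?T ^^ (k * p)) z)"
      by (rule step[OF mapT_pow_regular[OF z \<open>\<theta> > 0\<close>] cod])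
    finally show ?case using Suc by simp
  qed simp
  obtain v where v: "\<And>w. (G p ^^ 4) w = w + v"
    using quarter_map_pow4[OF qG] by blast
  have "(G p ^^ (4 * k)) w = w + of_nat k *\<^sub>R v" for k w
  proof (induction k)
    case (Suc k)
    have "(G p ^^ (4 * Suc k)) w = (G p ^^ 4) ((G p ^^ (4 * k)) w)"
      by (metis comp_apply funpow_add mult_Suc_right)
    then show ?case using Suc by (simp add: v algebra_simps)
  qed simp
  then have orb: "(?T ^^ (4 * k * p)) z = z + of_nat k *\<^sub>R v" for k
    using iter[of "4 * k"] by simp
  have "v = 0"
  proof (rule ccontr)
    assume "v \<noteq> 0"
    then obtain k :: nat where k: "real k * norm v > 2 * (2 + \<theta>)"
      using ex_less_of_nat_mult[of "norm v" "2 * (2 + \<theta>)"] by auto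
    \<comment> \<open>The sum of the side lengths 1 + \<theta> and 1 bounds the norm; twice this
      bound limits the distance of two points of an orbit.\<close>
    have bd: "norm w \<le> 2 + \<theta>" if "w \<in> regularX (\<theta>, \<epsilon>)" for w
    proof -
      have "w \<in> domT (\<theta>, \<epsilon>)" by (rule regularX_dom[OF that])
      then have "\<bar>fst w\<bar> \<le> 1 + \<theta>" "\<bar>snd w\<bar> \<le> 1"
        using \<open>\<theta> > 0\<close> by (auto simp: domT_def interior_sqC interior_rectR)
      then show ?thesis using norm_Pair_le[of "fst w" "snd w"] by simp
    qed
    have "norm (z + real k *\<^sub>R v) \<le> 2 + \<theta>"
      using bd[OF mapT_pow_regular[OF z \<open>\<theta> > 0\<close>, of "4 * k * p"]] unfolding orb[of k] .
    then have "norm (z + real k *\<^sub>R v) + norm z \<le> 2 * (2 + \<theta>)"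
      using bd[OF z] by simp
    moreover have "norm (real k *\<^sub>R v) \<le> norm (z + real k *\<^sub>R v) + norm z"
      using norm_triangle_ineq4[of "z + real k *\<^sub>R v" z] by simp
    ultimately have "norm (real k *\<^sub>R v) \<le> 2 * (2 + \<theta>)" by (rule order_trans[rotated])
    then have "real k * norm v \<le> 2 * (2 + \<theta>)" by simp
    then show False using k by (simp add: not_le[symmetric])
  qed
  then show ?thesis using orb[of 1] by simp
qed

lemma periodic_imp_periodicI:
  assumes z: "z \<in> regularX \<omega>" and q: "0 < q" "q \<le> n" "(mapT \<omega> ^^ q) z = z"
  shows "z \<in> periodicI \<omega> n"
proof -
  define u where "u = map (coding \<omega> z) [0..<q]"
  have per: "coding \<omega> z (m + q) = coding \<omega> z m" for m
    using coding_shift[of \<omega> q z m] q(3) by (simp add: add.commute)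
  have "coding \<omega> z m = coding \<omega> z (m mod q)" for m
  proof -
    have "coding \<omega> z (r + k * q) = coding \<omega> z r" for r k
    proof (induction k)
      case (Suc k)
      then show ?case using per[of "r + k * q"] by (simp add: add.assoc add.commute[of q])
    qed simp
    from this[of "m mod q" "m div q"] show ?thesis by simp
  qed
  then have cod: "coding \<omega> z = repeat_word u"
    using q(1) by (auto simp: u_def repeat_word_def fun_eq_iff)
  have "word_period (repeat_word u) \<le> q"
    unfolding word_period_def cod[symmetric] by (rule Least_le) (use per q in auto)
  moreover have "z \<in> cell \<omega> (repeat_word u)" using z cod by (simp add: cell_def)
  moreover have "u \<noteq> []" using q(1) by (simp add: u_def)
  ultimately show ?thesis unfolding periodicI_def using q(2) by force
qed

text \<open>The factor 4 is the exponent of the group of linear parts: a code of period p only gives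
  that the 4p-th iterate fixes the point.\<close>

lemma periodicI_imp_periodic:
  assumes z: "z \<in> periodicI (\<theta>, \<epsilon>) n" and "\<theta> > 0"
  obtains q where "0 < q" "q \<le> 4 * n" "(mapT (\<theta>, \<epsilon>) ^^ q) z = z"
proof -
  obtain u where u: "u \<noteq> []" "z \<in> cell (\<theta>, \<epsilon>) (repeat_word u)" "word_period (repeat_word u) \<le> n"
    using z unfolding periodicI_def by blast
  define p where "p = word_period (repeat_word u)"
  have "0 < p \<and> (\<forall>n. repeat_word u (n + p) = repeat_word u n)"
    unfolding p_def word_period_def
    by (rule LeastI[of _ "length u"]) (use u in \<open>auto simp: repeat_word_def\<close>)
  moreover have "coding (\<theta>, \<epsilon>) z = repeat_word u" "z \<in> regularX (\<theta>, \<epsilon>)"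
    using u(2) by (auto simp: cell_def)
  ultimately have "(mapT (\<theta>, \<epsilon>) ^^ (4 * p)) z = z"
    by (intro periodic_coding_imp_periodic \<open>\<theta> > 0\<close>) auto
  then show ?thesis using that[of "4 * p"] u(3) \<open>0 < p \<and> _\<close> by (simp add: p_def)
qed

text \<open>The sets removed at level n are squeezed between point periodicity up to n and up to 4n,
  and the factor is lost in the intersection over all n. Regular points that are not generic enter
  through the closure, since generic points with the same non-return property are arbitrarily close
  to them.\<close>

lemma aperiodicK_eq:
  assumes "\<theta> > 0"
  shows "aperiodicK (\<theta>, \<epsilon>) = (\<Inter>n. closure (nonper (\<theta>, \<epsilon>) n))"
proof -
  have 1: "regularX (\<theta>, \<epsilon>) - periodicI (\<theta>, \<epsilon>) n \<subseteq> closure (nonper (\<theta>, \<epsilon>) n)" for n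
  proof
    fix z assume z: "z \<in> regularX (\<theta>, \<epsilon>) - periodicI (\<theta>, \<epsilon>) n"
    then have np: "\<forall>q\<in>{1..n}. (mapT (\<theta>, \<epsilon>) ^^ q) z \<noteq> z"
      using periodic_imp_periodicI[of z "(\<theta>, \<epsilon>)" _ n] by (metis DiffE Suc_le_eq One_nat_def atLeastAtMost_iff)
    have ev: "eventually (\<lambda>w. 0 < fst w \<and> fst w < 1 + \<theta> \<and> 0 < snd w \<and> snd w < 1
      \<and> (\<forall>q\<in>{1..n}. (mapT (\<theta>, \<epsilon>) ^^ q) w \<noteq> w)) (nhds z)"
    proof -
      have "filterlim (\<lambda>w. (\<theta>, w)) (nhds (\<theta>, z)) (nhds z)"
        by (intro tendsto_intros filterlim_ident)
      from eventually_compose_filterlim[OF eventually_nonper[OF _ assms np] this] z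
      show ?thesis by simp
    qed
    then obtain V where V: "open V" "z \<in> V" "\<And>w. w \<in> V \<Longrightarrow> 0 < fst w \<and> fst w < 1 + \<theta> \<and> 0 < snd w \<and> snd w < 1
      \<and> (\<forall>q\<in>{1..n}. (mapT (\<theta>, \<epsilon>) ^^ q) w \<noteq> w)"
      unfolding eventually_nhds by blast
    show "z \<in> closure (nonper (\<theta>, \<epsilon>) n)"
      unfolding closure_iff_nhds_not_empty
    proof (intro allI impI)
      fix A U assume U: "U \<subseteq> A" "open U" "z \<in> U"
      obtain w where "w \<in> U \<inter> V" "w \<in> generic \<theta>"
        using generic_dense[of z \<theta> "U \<inter> V"] V U by auto
      then show "nonper (\<theta>, \<epsilon>) n \<inter> A \<noteq> {}"
        using V(3)[of w] U by (auto simp: nonper_def)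
    qed
  qed
  have 2: "nonper (\<theta>, \<epsilon>) (4 * n) \<subseteq> regularX (\<theta>, \<epsilon>) - periodicI (\<theta>, \<epsilon>) n" for n
  proof
    fix z assume z: "z \<in> nonper (\<theta>, \<epsilon>) (4 * n)"
    have "z \<notin> periodicI (\<theta>, \<epsilon>) n"
    proof
      assume "z \<in> periodicI (\<theta>, \<epsilon>) n"
      then obtain q where "0 < q" "q \<le> 4 * n" "(mapT (\<theta>, \<epsilon>) ^^ q) z = z"
        using periodicI_imp_periodic[OF _ assms] by blast
      then show False using z by (auto simp: nonper_def)
    qed
    then show "z \<in> regularX (\<theta>, \<epsilon>) - periodicI (\<theta>, \<epsilon>) n"
      using z generic_regular[OF assms] by (auto simp: nonper_def)
  qed
  show ?thesis
  proof
    show "aperiodicK (\<theta>, \<epsilon>) \<subseteq> (\<Inter>n. closure (nonper (\<theta>, \<epsilon>) n))"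
      unfolding aperiodicK_def setK_def using closure_minimal[OF 1 closed_closure] by blast
    show "(\<Inter>n. closure (nonper (\<theta>, \<epsilon>) n)) \<subseteq> aperiodicK (\<theta>, \<epsilon>)"
      unfolding aperiodicK_def setK_def using closure_mono[OF 2] by blast
  qed
qed

section \<open>Sets of Hausdorff measure zero\<close>

text \<open>No scale \<delta> appears: for s > 0 a small total already forces every single diameter
  to be small. This form is stable under countable unions and Lipschitz images and needs no supremum
  over scales.\<close>

definition cover_null :: "real \<Rightarrow> 'a::metric_space set \<Rightarrow> bool" where
  "cover_null s A \<longleftrightarrow> (\<forall>\<eta>>0. \<exists>U :: nat \<Rightarrow> 'a set. A \<subseteq> (\<Union>i. U i) \<and> (\<forall>i. bounded (U i)) \<and>
     (\<Sum>i. ennreal (diameter (U i) powr s)) < ennreal \<eta>)"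

lemma term_less_of_suminf_less:
  fixes f :: "nat \<Rightarrow> real"
  assumes "(\<Sum>i. ennreal (f i)) < ennreal \<eta>" "\<eta> > 0"
  shows "f i < \<eta>"
proof -
  have "ennreal (f i) \<le> (\<Sum>i. ennreal (f i))"
    using sum_le_suminf[of "\<lambda>i. ennreal (f i)" "{i}"] by auto
  then have "ennreal (f i) < ennreal \<eta>" using assms by simp
  then show ?thesis using assms(2) by (metis ennreal_leI not_le)
qed

text \<open>Scale 1 is enough, because powers of diameters at most 1 decrease when the exponent
  grows. The exponent s = 0 is included so that the lower bound for the dimension covers it
  too.\<close>

lemma hausdorff_measure_0_imp_cover_null:
  fixes A :: "'a::metric_space set"
  assumes "0 \<le> s" "s \<le> q" "0 < q" and 0: "hausdorff_measure s A = 0"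
  shows "cover_null q A"
  unfolding cover_null_def
proof (intro allI impI)
  fix \<eta> :: real assume "\<eta> > 0"
  have "hausdorff_premeasure s 1 A \<le> hausdorff_measure s A"
    unfolding hausdorff_measure_def by (rule SUP_upper) simp
  then have "hausdorff_premeasure s 1 A < ennreal \<eta>" using 0 \<open>\<eta> > 0\<close> by simp
  then obtain U where U: "A \<subseteq> (\<Union>i. U i)" "\<And>i. bounded (U i) \<and> diameter (U i) \<le> 1"
    "(\<Sum>i. ennreal (diameter_pow s (U i))) < ennreal \<eta>"
    unfolding hausdorff_premeasure_def INF_less_iff by auto
  have "diameter (U i) powr q \<le> diameter_pow s (U i)" for i
  proof -
    have d: "0 \<le> diameter (U i)" "diameter (U i) \<le> 1" using U(2)[of i] diameter_ge_0 by auto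
    show ?thesis
    proof (cases "U i = {} \<or> diameter (U i) = 0")
      case True
      then show ?thesis by (auto simp: diameter_pow_def)
    next
      case False
      then have "diameter (U i) powr q \<le> diameter (U i) powr s"
        using d assms by (intro powr_mono') auto
      moreover have "diameter (U i) powr q \<le> 1" using d assms by (intro powr_le1) auto
      ultimately show ?thesis using False by (auto simp: diameter_pow_def)
    qed
  qed
  then have "(\<Sum>i. ennreal (diameter (U i) powr q)) \<le> (\<Sum>i. ennreal (diameter_pow s (U i)))"
    by (intro suminf_le) (auto intro: ennreal_leI)
  then show "\<exists>U. A \<subseteq> (\<Union>i. U i) \<and> (\<forall>i. bounded (U i)) \<and> (\<Sum>i. ennreal (diameter (U i) powr q)) < ennreal \<eta>"
    using U by (intro exI[of _ U]) auto
qed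

lemma cover_null_imp_hausdorff_measure_0:
  fixes A :: "'a::metric_space set"
  assumes "0 < s" and c: "cover_null s A"
  shows "hausdorff_measure s A = 0"
proof -
  have "hausdorff_premeasure s \<delta> A = 0" if "\<delta> > 0" for \<delta>
  proof -
    have "hausdorff_premeasure s \<delta> A \<le> 0 + ennreal e" if "e > 0" for e
    proof -
      \<comment> \<open>The second bound forces every diameter of the cover below \<delta>, since
        each term is at most the total.\<close>
      define \<eta> where "\<eta> = min e (\<delta> powr s)"
      have \<eta>: "\<eta> > 0" using \<open>e > 0\<close> \<open>\<delta> > 0\<close> by (simp add: \<eta>_def)
      then obtain U where U: "A \<subseteq> (\<Union>i. U i)" "\<And>i. bounded (U i)"
        "(\<Sum>i. ennreal (diameter (U i) powr s)) < ennreal \<eta>"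
        using c unfolding cover_null_def by blast
      have "diameter (U i) \<le> \<delta>" for i
      proof -
        have "diameter (U i) powr s < \<delta> powr s"
          using term_less_of_suminf_less[OF U(3) \<eta>, of i] by (simp add: \<eta>_def)
        then show ?thesis
          using powr_mono2[of s \<delta> "diameter (U i)"] \<open>\<delta> > 0\<close> \<open>0 < s\<close> by linarith
      qed
      moreover have "diameter_pow s (U i) = diameter (U i) powr s" for i
        using \<open>0 < s\<close> by (simp add: diameter_pow_def)
      ultimately have "hausdorff_premeasure s \<delta> A \<le> (\<Sum>i. ennreal (diameter (U i) powr s))"
        unfolding hausdorff_premeasure_def using U by (intro INF_lower2[of U]) auto
      also have "\<dots> \<le> ennreal e"
        using U(3) order_trans[OF less_imp_le ennreal_leI[of \<eta> e]] by (simp add: \<eta>_def)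
      finally show ?thesis by simp
    qed
    then have "hausdorff_premeasure s \<delta> A \<le> 0" by (rule ennreal_le_epsilon)
    then show ?thesis by simp
  qed
  then show ?thesis unfolding hausdorff_measure_def by (simp add: SUP_eq_const)
qed

lemma cover_null_mono:
  assumes "0 < s" "s \<le> q" "cover_null s A"
  shows "cover_null q A"
  using hausdorff_measure_0_imp_cover_null[of s q A] cover_null_imp_hausdorff_measure_0[of s A] assms by simp

text \<open>Rational exponents are dense, and nullity is inherited by larger exponents. The
  restriction to rationals later makes the exceptional set of parameters a countable union.\<close>

lemma hausdorff_dim_eqI:
  assumes "0 \<le> d"
    and up: "\<And>q. d < q \<Longrightarrow> q \<in> \<rat> \<Longrightarrow> cover_null q A"
    and low: "\<And>q. 0 < q \<Longrightarrow> q < d \<Longrightarrow> q \<in> \<rat> \<Longrightarrow> \<not> cover_null q A"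
  shows "hausdorff_dim A = ereal d"
  unfolding hausdorff_dim_def
proof (rule antisym)
  show "Inf {ereal s |s. 0 \<le> s \<and> hausdorff_measure s A = 0} \<le> ereal d"
  proof (rule ereal_le_epsilon2)
    fix e :: real assume "e > 0"
    then obtain q where q: "q \<in> \<rat>" "d < q" "q < d + e"
      using Rats_dense_in_real[of d "d + e"] by auto
    then have "hausdorff_measure q A = 0"
      using up assms(1) by (intro cover_null_imp_hausdorff_measure_0) auto
    then have "Inf {ereal s |s. 0 \<le> s \<and> hausdorff_measure s A = 0} \<le> ereal q"
      using q assms(1) by (intro Inf_lower) auto
    then show "Inf {ereal s |s. 0 \<le> s \<and> hausdorff_measure s A = 0} \<le> ereal d + ereal e"
      using q by (simp add: order_trans)
  qed
  show "ereal d \<le> Inf {ereal s |s. 0 \<le> s \<and> hausdorff_measure s A = 0}"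
  proof (rule Inf_greatest, clarify)
    fix s assume s: "0 \<le> s" "hausdorff_measure s A = 0"
    show "ereal d \<le> ereal s"
    proof (rule ccontr)
      assume "\<not> ?thesis"
      then obtain q where q: "q \<in> \<rat>" "s < q" "q < d"
        using Rats_dense_in_real[of s d] by auto
      then show False
        using low[of q] hausdorff_measure_0_imp_cover_null[of s q A] s by auto
    qed
  qed
qed

lemma cover_null_subset: "cover_null s A \<Longrightarrow> B \<subseteq> A \<Longrightarrow> cover_null s B"
  unfolding cover_null_def by (meson order_trans)

lemma cover_null_UN:
  fixes A :: "nat \<Rightarrow> 'a::metric_space set"
  assumes "\<And>n. cover_null s (A n)"
  shows "cover_null s (\<Union>n. A n)"
  unfolding cover_null_def
proof (intro allI impI)
  fix \<eta> :: real assume "\<eta> > 0"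
  \<comment> \<open>The budgets add up to \<eta>/2, which leaves room for the strict
    inequality.\<close>
  define z where "z n = \<eta> / 2 * (1 / 2) ^ Suc n" for n :: nat
  have z: "z n > 0" for n using \<open>\<eta> > 0\<close> by (simp add: z_def)
  have zs: "z sums (\<eta> / 2)"
    unfolding z_def using sums_mult[OF power_half_series, of "\<eta> / 2"] by simp
  have "\<forall>n. \<exists>U :: nat \<Rightarrow> 'a set. A n \<subseteq> (\<Union>i. U i) \<and> (\<forall>i. bounded (U i)) \<and>
     (\<Sum>i. ennreal (diameter (U i) powr s)) < ennreal (z n)"
    using assms z unfolding cover_null_def by blast
  then obtain U where U: "\<And>n. A n \<subseteq> (\<Union>i. U n i)" "\<And>n i. bounded (U n i)"
    "\<And>n. (\<Sum>i. ennreal (diameter (U n i) powr s)) < ennreal (z n)"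
    by metis
  define V where "V = (\<lambda>k. U (fst (prod_decode k)) (snd (prod_decode k)))"
  have Vm: "U n i = V (prod_encode (n, i))" for n i by (simp add: V_def)
  have "(\<Sum>k. ennreal (diameter (V k) powr s)) = (\<Sum>n. \<Sum>i. ennreal (diameter (U n i) powr s))"
  proof -
    have "(\<Sum>k. (\<lambda>q. ennreal (diameter (U (fst q) (snd q)) powr s)) (prod_decode k)) =
       (\<Sum>n. \<Sum>i. ennreal (diameter (U n i) powr s))"
      by (rule suminf_ennreal_2dimen) simp
    then show ?thesis by (simp add: V_def)
  qed
  also have "\<dots> \<le> (\<Sum>n. ennreal (z n))"
    using U(3) by (intro suminf_le) (auto intro: less_imp_le)
  also have "\<dots> = ennreal (\<eta> / 2)"
    using zs z by (subst suminf_ennreal2) (auto simp: sums_iff less_imp_le)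
  also have "\<dots> < ennreal \<eta>" using \<open>\<eta> > 0\<close> by (simp add: ennreal_lessI)
  finally have "(\<Sum>k. ennreal (diameter (V k) powr s)) < ennreal \<eta>" .
  moreover have "(\<Union>n. A n) \<subseteq> (\<Union>k. V k)"
    using U(1) by (fastforce simp: Vm)
  moreover have "bounded (V k)" for k using U(2) by (simp add: V_def)
  ultimately show "\<exists>U. (\<Union>n. A n) \<subseteq> (\<Union>i. U i) \<and> (\<forall>i. bounded (U i)) \<and>
     (\<Sum>i. ennreal (diameter (U i) powr s)) < ennreal \<eta>" by blast
qed

lemma cover_null_finite_UN:
  fixes A :: "'a \<Rightarrow> 'b::metric_space set"
  assumes "finite I" "\<And>i. i \<in> I \<Longrightarrow> cover_null s (A i)" "s > 0"
  shows "cover_null s (\<Union>i\<in>I. A i)"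
proof (cases "I = {}")
  case True
  have "(\<Sum>i::nat. ennreal (diameter ({} :: 'b set) powr s)) = 0" by simp
  then have "\<exists>U :: nat \<Rightarrow> 'b set. {} \<subseteq> (\<Union>i. U i) \<and> (\<forall>i. bounded (U i)) \<and>
     (\<Sum>i. ennreal (diameter (U i) powr s)) < ennreal \<eta>" if "\<eta> > 0" for \<eta>
    using that by (intro exI[of _ "\<lambda>_. {}"]) simp
  then show ?thesis using True unfolding cover_null_def by simp
next
  case False
  then have "(\<Union>i\<in>I. A i) = (\<Union>n. A (from_nat_into I n))"
    using range_from_nat_into[OF False countable_finite[OF assms(1)]] by (metis image_image)
  then show ?thesis using cover_null_UN[of s "\<lambda>n. A (from_nat_into I n)"] from_nat_into[OF False] assms
    by metis
qed

text \<open>A Lipschitz map multiplies the total by at most \<open>L powr s\<close>. The covering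
  sets are first cut down to A, because the Lipschitz bound is assumed only there.\<close>

lemma cover_null_image:
  fixes f :: "'a::real_normed_vector \<Rightarrow> 'b::real_normed_vector"
  assumes "cover_null s A" "L > 0" "\<And>x y. x \<in> A \<Longrightarrow> y \<in> A \<Longrightarrow> dist (f x) (f y) \<le> L * dist x y" "s > 0"
  shows "cover_null s (f ` A)"
  unfolding cover_null_def
proof (intro allI impI)
  fix \<eta> :: real assume "\<eta> > 0"
  then have "\<eta> / L powr s > 0" using assms(2) by simp
  then obtain U where U: "A \<subseteq> (\<Union>i. U i)" "\<And>i. bounded (U i)"
    "(\<Sum>i. ennreal (diameter (U i) powr s)) < ennreal (\<eta> / L powr s)"
    using assms(1) unfolding cover_null_def by blast
  have le: "dist (f x) (f y) \<le> L * diameter (U i)" if "x \<in> U i \<inter> A" "y \<in> U i \<inter> A" for x y i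
    using assms(3)[of x y] diameter_bounded_bound[OF U(2), of x i y] that assms(2)
    by (meson IntD1 IntD2 mult_left_mono order_trans less_imp_le)
  have b: "bounded (f ` (U i \<inter> A))" for i
    unfolding bounded_any_center[of _ "f (SOME x. x \<in> U i \<inter> A)"]
    using le some_in_eq[of "U i \<inter> A"] by (intro exI[of _ "L * diameter (U i)"]) blast
  have d: "diameter (f ` (U i \<inter> A)) \<le> L * diameter (U i)" for i
  proof (rule diameter_le)
    show "f ` (U i \<inter> A) \<noteq> {} \<or> 0 \<le> L * diameter (U i)"
      using assms(2) diameter_ge_0[OF U(2)] by simp
    show "norm (x - y) \<le> L * diameter (U i)" if "x \<in> f ` (U i \<inter> A)" "y \<in> f ` (U i \<inter> A)" for x y
      using le that by (auto simp: dist_norm)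
  qed
  have "(\<Sum>i. ennreal (diameter (f ` (U i \<inter> A)) powr s)) \<le> (\<Sum>i. ennreal (L powr s) * ennreal (diameter (U i) powr s))"
  proof (intro suminf_le)
    fix i
    have "diameter (f ` (U i \<inter> A)) powr s \<le> (L * diameter (U i)) powr s"
      using d b assms(4) by (intro powr_mono2 diameter_ge_0) auto
    also have "\<dots> = L powr s * diameter (U i) powr s"
      using assms(2) diameter_ge_0[OF U(2)] by (simp add: powr_mult)
    finally show "ennreal (diameter (f ` (U i \<inter> A)) powr s) \<le> ennreal (L powr s) * ennreal (diameter (U i) powr s)"
      by (simp add: ennreal_mult[symmetric] ennreal_leI)
  qed auto
  also have "\<dots> = ennreal (L powr s) * (\<Sum>i. ennreal (diameter (U i) powr s))" by simp
  also have "\<dots> < ennreal (L powr s) * ennreal (\<eta> / L powr s)"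
    using U(3) assms(2) by (intro ennreal_mult_strict_left_mono) auto
  also have "\<dots> = ennreal \<eta>" using assms(2) \<open>\<eta> > 0\<close> by (simp add: ennreal_mult[symmetric])
  finally show "\<exists>U. f ` A \<subseteq> (\<Union>i. U i) \<and> (\<forall>i. bounded (U i)) \<and> (\<Sum>i. ennreal (diameter (U i) powr s)) < ennreal \<eta>"
    using U(1) b by (intro exI[of _ "\<lambda>i. f ` (U i \<inter> A)"]) blast
qed

text \<open>Exponents above the topological dimension 2 of the plane suffice; 3 keeps the arithmetic simple.\<close>

lemma cover_null_3_square:
  fixes A :: "(real \<times> real) set"
  assumes "A \<subseteq> {0..2} \<times> {0..2}"
  shows "cover_null 3 A"
  unfolding cover_null_def
proof (intro allI impI)
  fix \<eta> :: real assume "\<eta> > 0"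
  \<comment> \<open>At most (3N)^2 squares are used, each contributing at most (2/N)^3, so the total
    is at most 72/N.\<close>
  obtain N :: nat where N: "72 / \<eta> < real N" using reals_Archimedean2 by blast
  then have "N > 0" using \<open>\<eta> > 0\<close> by (metis divide_pos_pos gr0I of_nat_0 order_less_asym zero_less_numeral)
  \<comment> \<open>Each axis needs one index beyond 2N - 1, because the coordinate 2 falls into the
    interval with index 2N.\<close>
  define M where "M = 2 * N + 1"
  define B where "B i j = {real i / N .. real (Suc i) / N} \<times> {real j / N .. real (Suc j) / N}" for i j
  define U where "U n = (if n < M * M then B (n div M) (n mod M) else {})" for n
  have "A \<subseteq> (\<Union>n. U n)"
  proof
    fix z assume "z \<in> A"
    then obtain x y where xy: "z = (x, y)" "0 \<le> x" "x \<le> 2" "0 \<le> y" "y \<le> 2" using assms by auto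
    have *: "\<exists>i<M. real i / N \<le> x \<and> x \<le> real (Suc i) / N" if "0 \<le> x" "x \<le> 2" for x :: real
    proof (intro exI[of _ "nat \<lfloor>N * x\<rfloor>"] conjI)
      have f: "real (nat \<lfloor>N * x\<rfloor>) \<le> N * x" "N * x < real (nat \<lfloor>N * x\<rfloor>) + 1"
        using that by (auto simp: of_nat_nat)
      have "N * x \<le> 2 * N" using mult_left_mono[OF that(2), of "real N"] by simp
      then have "real (nat \<lfloor>N * x\<rfloor>) < real M" using f unfolding M_def by simp
      then show "nat \<lfloor>N * x\<rfloor> < M" by simp
      show "real (nat \<lfloor>N * x\<rfloor>) / N \<le> x" "x \<le> real (Suc (nat \<lfloor>N * x\<rfloor>)) / N"
        using f \<open>N > 0\<close> by (simp_all add: field_simps)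
    qed
    obtain i j where ij: "i < M" "j < M" "z \<in> B i j"
      using *[of x] *[of y] xy unfolding B_def by auto
    have "i * M + j < M * M"
    proof -
      have "i * M + j < Suc i * M" using ij by simp
      also have "\<dots> \<le> M * M" using ij(1) by (intro mult_le_mono1) simp
      finally show ?thesis .
    qed
    then have "z \<in> U (i * M + j)" using ij by (simp add: U_def)
    then show "z \<in> (\<Union>n. U n)" by blast
  qed
  moreover have bU: "bounded (U n)" for n
    by (auto simp: U_def B_def bounded_Times)
  moreover have "(\<Sum>n. ennreal (diameter (U n) powr 3)) < ennreal \<eta>"
  proof -
    have dU: "diameter (U n) \<le> 2 / N" for n
    proof (rule diameter_le)
      show "U n \<noteq> {} \<or> 0 \<le> 2 / real N" by simp
      fix p q assume pq: "p \<in> U n" "q \<in> U n"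
      have "\<bar>fst p - fst q\<bar> \<le> 1 / N" "\<bar>snd p - snd q\<bar> \<le> 1 / N"
        using pq by (auto simp: U_def B_def add_divide_distrib abs_le_iff split: if_splits)
      then show "norm (p - q) \<le> 2 / N"
        using norm_Pair_le[of "fst p - fst q" "snd p - snd q"] by (cases p; cases q) simp
    qed
    have "(\<Sum>n. ennreal (diameter (U n) powr 3)) = (\<Sum>n<M * M. ennreal (diameter (U n) powr 3))"
      by (rule suminf_finite) (auto simp: U_def)
    also have "\<dots> \<le> (\<Sum>n<M * M. ennreal (8 / N ^ 3))"
    proof (intro sum_mono ennreal_leI)
      fix n
      have "diameter (U n) powr 3 \<le> (2 / N) powr 3"
        using dU bU by (intro powr_mono2 diameter_ge_0) auto
      also have "\<dots> = 8 / N ^ 3" using \<open>N > 0\<close> by (simp add: powr_numeral power_divide)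
      finally show "diameter (U n) powr 3 \<le> 8 / N ^ 3" .
    qed
    also have "\<dots> = ennreal (real (M * M) * (8 / N ^ 3))"
      by (subst sum_ennreal) simp_all
    also have "\<dots> < ennreal \<eta>"
    proof (rule ennreal_lessI[OF \<open>\<eta> > 0\<close>])
      have "M \<le> 3 * N" using \<open>N > 0\<close> by (simp add: M_def)
      then have "M * M \<le> 3 * N * (3 * N)" by (rule mult_le_mono) fact
      then have "real (M * M) \<le> real (3 * N * (3 * N))" by (rule of_nat_mono)
      then have "real (M * M) * (8 / N ^ 3) \<le> real (3 * N * (3 * N)) * (8 / N ^ 3)"
        by (rule mult_right_mono) simp
      also have "\<dots> = 72 / N" using \<open>N > 0\<close> by (simp add: field_simps power3_eq_cube)
      also have "\<dots> < \<eta>" using N \<open>N > 0\<close> \<open>\<eta> > 0\<close> by (simp add: field_simps)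
      finally show "real (M * M) * (8 / N ^ 3) < \<eta>" .
    qed
    finally show ?thesis .
  qed
  ultimately show "\<exists>U. A \<subseteq> (\<Union>i. U i) \<and> (\<forall>i. bounded (U i)) \<and> (\<Sum>i. ennreal (diameter (U i) powr 3)) < ennreal \<eta>"
    by blast
qed

section \<open>Covers by countably many candidate balls\<close>

definition rat_balls :: "((real \<times> real) \<times> real) set" where
  "rat_balls = (\<rat> \<times> \<rat>) \<times> (\<rat> \<inter> {0<..})"

lemma countable_rat_balls: "countable rat_balls"
  unfolding rat_balls_def
  by (rule countable_SIGMA, rule countable_SIGMA) (simp_all add: countable_rat)

text \<open>The ball is centred near a point of U and its radius is slightly larger than the whole
  diameter. Continuity of \<open>r powr s\<close> on [0,\<infinity>), including at 0, keeps the cost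
  of the enlargement below \<zeta> even for sets of diameter 0.\<close>

lemma bounded_subset_rat_ball:
  fixes U :: "(real \<times> real) set"
  assumes "bounded U" "\<zeta> > 0" "s > 0"
  obtains c r where "(c, r) \<in> rat_balls" "U \<subseteq> ball c r" "r powr s < diameter U powr s + \<zeta>"
proof -
  let ?d = "diameter U"
  have d: "?d \<ge> 0" using assms(1) by (rule diameter_ge_0)
  have "continuous_on {0..} (\<lambda>r::real. r powr s)"
    using assms(3) by (intro continuous_on_powr') (auto intro: continuous_intros)
  then obtain e where e: "e > 0" "\<And>r. r \<ge> 0 \<Longrightarrow> \<bar>r - ?d\<bar> < e \<Longrightarrow> \<bar>r powr s - ?d powr s\<bar> < \<zeta>"
    using d assms(2) unfolding continuous_on_iff dist_real_def by (metis atLeast_iff)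
  obtain r where r: "r \<in> \<rat>" "?d + e / 2 < r" "r < ?d + e"
    using Rats_dense_in_real[of "?d + e / 2" "?d + e"] e(1) by auto
  \<comment> \<open>If U is empty, x is an arbitrary point and the inclusion below is trivial.
    Errors of e/4 per coordinate move the centre by at most e/2, which the radius absorbs.\<close>
  define x where "x = (SOME x. x \<in> U)"
  obtain a where a: "a \<in> \<rat>" "fst x - e / 4 < a" "a < fst x + e / 4"
    using Rats_dense_in_real[of "fst x - e / 4" "fst x + e / 4"] e(1) by auto
  obtain b where b: "b \<in> \<rat>" "snd x - e / 4 < b" "b < snd x + e / 4"
    using Rats_dense_in_real[of "snd x - e / 4" "snd x + e / 4"] e(1) by auto
  have "dist (a, b) x \<le> e / 2"
    using norm_Pair_le[of "a - fst x" "b - snd x"] a b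
    by (cases x) (auto simp: dist_norm)
  have "U \<subseteq> ball (a, b) r"
  proof
    fix y assume y: "y \<in> U"
    then have "x \<in> U" unfolding x_def by (rule someI)
    then have "dist x y \<le> ?d" using diameter_bounded_bound[OF assms(1) _ y] by blast
    then show "y \<in> ball (a, b) r"
      using dist_triangle[of "(a, b)" y x] \<open>dist (a, b) x \<le> e / 2\<close> r by simp
  qed
  moreover have "r powr s < ?d powr s + \<zeta>" using e(2)[of r] r d e(1) by (auto simp: abs_less_iff)
  moreover have "((a, b), r) \<in> rat_balls" using a b r d e(1) by (auto simp: rat_balls_def)
  ultimately show ?thesis using that by blast
qed

text \<open>Half of \<eta> pays for a countable cover, the other half for enlarging its members to
  open rational balls; compactness then leaves finitely many.\<close>

lemma cover_null_compact_balls: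
  fixes K :: "(real \<times> real) set"
  assumes "compact K" "cover_null s K" "s > 0" "\<eta> > 0"
  obtains F where "finite F" "F \<subseteq> rat_balls" "K \<subseteq> (\<Union>(c, r)\<in>F. ball c r)" "(\<Sum>(c, r)\<in>F. r powr s) < \<eta>"
proof -
  obtain U where U: "K \<subseteq> (\<Union>i. U i)" "\<And>i. bounded (U i)"
    "(\<Sum>i. ennreal (diameter (U i) powr s)) < ennreal (\<eta> / 2)"
    using assms(2,4) unfolding cover_null_def by (meson half_gt_zero)
  define z where "z n = \<eta> / 2 * (1 / 2) ^ Suc n" for n :: nat
  have z: "z n > 0" for n using \<open>\<eta> > 0\<close> by (simp add: z_def)
  have zs: "z sums (\<eta> / 2)"
    unfolding z_def using sums_mult[OF power_half_series, of "\<eta> / 2"] by simp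
  have "\<exists>p. p \<in> rat_balls \<and> U i \<subseteq> ball (fst p) (snd p) \<and> snd p powr s < diameter (U i) powr s + z i" for i
    using bounded_subset_rat_ball[OF U(2) z assms(3), of i i] by (metis fst_conv snd_conv)
  then obtain p where p: "\<And>i. p i \<in> rat_balls" "\<And>i. U i \<subseteq> ball (fst (p i)) (snd (p i))"
    "\<And>i. snd (p i) powr s < diameter (U i) powr s + z i"
    by metis
  have "K \<subseteq> (\<Union>i\<in>UNIV. ball (fst (p i)) (snd (p i)))" using U(1) p(2) by blast
  then obtain J where J: "finite J" "K \<subseteq> (\<Union>i\<in>J. ball (fst (p i)) (snd (p i)))"
    by (rule compactE_image[OF assms(1) open_ball])
  \<comment> \<open>Different indices may select the same ball, so summing over the set of balls can
    only decrease the total.\<close>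
  have "(\<Sum>(c, r)\<in>p ` J. r powr s) \<le> (\<Sum>i\<in>J. snd (p i) powr s)"
    using sum_image_le[OF J(1), of "\<lambda>q. snd q powr s" p] by (simp add: case_prod_unfold comp_def)
  also have "\<dots> \<le> (\<Sum>i\<in>J. diameter (U i) powr s + z i)"
    using p(3) by (intro sum_mono) (auto intro: less_imp_le)
  also have "\<dots> = (\<Sum>i\<in>J. diameter (U i) powr s) + (\<Sum>i\<in>J. z i)" by (rule sum.distrib)
  also have "(\<Sum>i\<in>J. z i) \<le> \<eta> / 2"
    using sum_le_suminf[of z J] zs z J(1) by (auto simp: sums_iff less_imp_le)
  also have "(\<Sum>i\<in>J. diameter (U i) powr s) < \<eta> / 2"
  proof -
    have "ennreal (\<Sum>i\<in>J. diameter (U i) powr s) = (\<Sum>i\<in>J. ennreal (diameter (U i) powr s))"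
      by (rule sum_ennreal[symmetric]) simp
    also have "\<dots> \<le> (\<Sum>i. ennreal (diameter (U i) powr s))"
      using J(1) by (intro sum_le_suminf) auto
    finally have "ennreal (\<Sum>i\<in>J. diameter (U i) powr s) < ennreal (\<eta> / 2)" using U(3) by simp
    then show ?thesis by (metis ennreal_leI not_le)
  qed
  finally have "(\<Sum>(c, r)\<in>p ` J. r powr s) < \<eta>" by simp
  then show ?thesis using that[of "p ` J"] J p(1) by (auto simp: case_prod_unfold)
qed

text \<open>The counterpart with closed balls: a finite union of them is closed, so it contains the
  closure of any subset. The factor \<open>2 powr s\<close> accounts for a diameter being twice the
  radius.\<close>

lemma cover_null_cballs:
  fixes K :: "(real \<times> real) set"
  assumes "s > 0" and ex: "\<And>\<eta>. \<eta> > 0 \<Longrightarrow> \<exists>F. finite F \<and> F \<subseteq> rat_balls \<and>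
    K \<subseteq> (\<Union>(c, r)\<in>F. cball c r) \<and> (\<Sum>(c, r)\<in>F. r powr s) < \<eta>"
  shows "cover_null s K"
  unfolding cover_null_def
proof (intro allI impI)
  fix \<eta> :: real assume "\<eta> > 0"
  then obtain F where F: "finite F" "F \<subseteq> rat_balls" "K \<subseteq> (\<Union>(c, r)\<in>F. cball c r)"
    "(\<Sum>(c, r)\<in>F. r powr s) < \<eta> / 2 powr s"
    using ex[of "\<eta> / 2 powr s"] by auto
  obtain xs where xs: "set xs = F" "distinct xs" using finite_distinct_list[OF F(1)] by blast
  define U where "U i = (if i < length xs then cball (fst (xs ! i)) (snd (xs ! i)) else {})" for i
  have "K \<subseteq> (\<Union>i. U i)"
  proof
    fix z assume "z \<in> K"
    then obtain q where q: "q \<in> F" "z \<in> cball (fst q) (snd q)" using F(3) by fastforce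
    then obtain i where "i < length xs" "q = xs ! i" using xs(1) by (metis in_set_conv_nth)
    then show "z \<in> (\<Union>i. U i)" using q(2) by (auto simp: U_def intro!: exI[of _ i])
  qed
  moreover have bU: "bounded (U i)" for i by (simp add: U_def)
  moreover have "(\<Sum>i. ennreal (diameter (U i) powr s)) < ennreal \<eta>"
  proof -
    have "(\<Sum>i. ennreal (diameter (U i) powr s)) = (\<Sum>i<length xs. ennreal (diameter (U i) powr s))"
      by (rule suminf_finite) (auto simp: U_def)
    also have "\<dots> \<le> (\<Sum>i<length xs. ennreal (2 powr s * snd (xs ! i) powr s))"
    proof (intro sum_mono ennreal_leI)
      fix i assume i: "i \<in> {..<length xs}"
      then have "xs ! i \<in> rat_balls" using F(2) xs(1) by auto
      then have r: "snd (xs ! i) > 0" by (auto simp: rat_balls_def)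
      have "diameter (U i) powr s \<le> (2 * snd (xs ! i)) powr s"
        using bU[of i] r assms(1) i by (intro powr_mono2 diameter_ge_0) (auto simp: U_def)
      then show "diameter (U i) powr s \<le> 2 powr s * snd (xs ! i) powr s"
        using r by (simp add: powr_mult)
    qed
    also have "\<dots> = ennreal (\<Sum>i<length xs. 2 powr s * snd (xs ! i) powr s)"
      by (rule sum_ennreal) simp
    also have "(\<Sum>i<length xs. 2 powr s * snd (xs ! i) powr s) = 2 powr s * (\<Sum>(c, r)\<in>F. r powr s)"
    proof -
      have "(\<Sum>q\<in>F. snd q powr s) = (\<Sum>i<length xs. snd (xs ! i) powr s)"
        using sum.reindex_bij_betw[OF bij_betw_nth[OF xs(2) refl xs(1)[symmetric]], of "\<lambda>q. snd q powr s"] by simp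
      then show ?thesis by (simp add: sum_distrib_left case_prod_unfold)
    qed
    also have "ennreal \<dots> < ennreal \<eta>"
      using F(4) \<open>\<eta> > 0\<close> by (intro ennreal_lessI) (auto simp: field_simps)
    finally show ?thesis .
  qed
  ultimately show "\<exists>U. K \<subseteq> (\<Union>i. U i) \<and> (\<forall>i. bounded (U i)) \<and> (\<Sum>i. ennreal (diameter (U i) powr s)) < ennreal \<eta>"
    by blast
qed

section \<open>Induced maps and the aperiodic set\<close>

lemma dist_quarter_map:
  assumes "quarter_map g"
  shows "dist (g z) (g w) = dist z w"
proof -
  obtain s t c d where g: "s \<in> {-1, 1}" "t \<in> {-1, 1}"
    "g = (\<lambda>z. (s * fst z + c, t * snd z + d)) \<or> g = (\<lambda>z. (s * snd z + c, t * fst z + d))"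
    using assms unfolding quarter_map_def by blast
  from g(3) show ?thesis
  proof
    assume "g = (\<lambda>z. (s * fst z + c, t * snd z + d))"
    then show ?thesis using g(1,2)
      by (auto simp: dist_prod_def dist_real_def power2_commute)
  next
    assume "g = (\<lambda>z. (s * snd z + c, t * fst z + d))"
    then show ?thesis using g(1,2)
      by (auto simp: dist_prod_def dist_real_def power2_commute)
  qed
qed

lemma bounded_nonper: "bounded (nonper (\<theta>, \<epsilon>) n)"
proof (rule bounded_subset)
  show "bounded (cbox (0, 0) (1 + \<theta>, 1::real))" by (rule bounded_cbox)
  show "nonper (\<theta>, \<epsilon>) n \<subseteq> cbox (0, 0) (1 + \<theta>, 1)"
    by (auto simp: nonper_def generic_def mem_Times_iff cbox_Pair_eq)
qed

lemma compact_closure_nonper: "compact (closure (nonper (\<theta>, \<epsilon>) n))"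
  using bounded_nonper by (simp add: compact_closure)

text \<open>The similarity \<open>\<lambda>z. g0 (c *\<^sub>R z)\<close> carries the system with
  parameter \<theta>' to an induced map of the system with parameter \<theta>. In
  \<open>cover\<close> a point is tied to the induced domain twice: by an iterate, which transports
  periods, and by an isometry from a finite list, which transports the geometry. The constants are
  those of the applications below: return times are at most 3, and the left-over points are fixed by
  an iterate of order at most 8.\<close>

locale induced_map =
  fixes \<theta> \<theta>' c :: real and \<epsilon> \<epsilon>' :: int and g0 :: "point \<Rightarrow> point" and H :: "(point \<Rightarrow> point) set"
  assumes pos: "\<theta> > 0" "\<theta>' > 0" "c > 0"
    and g0: "quarter_map g0" and H: "finite H" "\<And>g. g \<in> H \<Longrightarrow> quarter_map g"
    and gen: "\<And>z. z \<in> generic \<theta>' \<Longrightarrow> g0 (c *\<^sub>R z) \<in> generic \<theta>"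
    and ret: "\<And>z. z \<in> generic \<theta>' \<Longrightarrow>
      \<exists>r\<in>{1..3}. g0 (c *\<^sub>R mapT (\<theta>', \<epsilon>') z) = (mapT (\<theta>, \<epsilon>) ^^ r) (g0 (c *\<^sub>R z))"
    and cover: "\<And>z. z \<in> generic \<theta> \<Longrightarrow> (\<exists>q\<in>{1..8}. (mapT (\<theta>, \<epsilon>) ^^ q) z = z) \<or>
      (\<exists>g\<in>H. \<exists>k. \<exists>w\<in>generic \<theta>'. z = g (c *\<^sub>R w) \<and> z = (mapT (\<theta>, \<epsilon>) ^^ k) (g0 (c *\<^sub>R w)))"
begin

lemma dist_similarity: "quarter_map g \<Longrightarrow> dist (g (c *\<^sub>R z)) (g (c *\<^sub>R w)) = c * dist z w"
  using dist_quarter_map[of g "c *\<^sub>R z" "c *\<^sub>R w"] pos(3)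
  by (simp add: dist_norm scaleR_diff_right[symmetric] del: scaleR_diff_right)

text \<open>Bounded return times distort periods by a bounded factor, so the sets
  \<open>nonper\<close> of both systems can be compared level by level. Similarities are continuous
  and the closures compact, which carries the comparison over to the closures.\<close>

lemma aperiodicK_induced:
  shows "(\<lambda>z. g0 (c *\<^sub>R z)) ` aperiodicK (\<theta>', \<epsilon>') \<subseteq> aperiodicK (\<theta>, \<epsilon>)"
    and "aperiodicK (\<theta>, \<epsilon>) \<subseteq> (\<Union>g\<in>H. (\<lambda>z. g (c *\<^sub>R z)) ` aperiodicK (\<theta>', \<epsilon>'))"
proof -
  let ?\<psi> = "\<lambda>z. g0 (c *\<^sub>R z)"
  define T where "T = mapT (\<theta>, \<epsilon>)"
  define T' where "T' = mapT (\<theta>', \<epsilon>')"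
  note ret = ret[folded T_def T'_def] and cover = cover[folded T_def]
  have inj: "g (c *\<^sub>R z) = g (c *\<^sub>R w) \<longleftrightarrow> z = w" if "quarter_map g" for g z w
    using dist_similarity[OF that, of z w] pos(3) by auto
  have cont: "continuous_on S (\<lambda>z. g (c *\<^sub>R z))" if "quarter_map g" for g S
  proof (rule continuous_on_compose2[where g = g and t = UNIV])
    show "continuous_on UNIV g"
      by (auto simp: continuous_on_iff dist_quarter_map[OF that])
  qed (intro continuous_intros | simp)+
  have gen': "(T' ^^ j) z \<in> generic \<theta>'" if "z \<in> generic \<theta>'" for j z
    unfolding T'_def by (rule mapT_pow_generic) (use that pos in auto)
  have iter: "\<exists>R\<in>{j..3 * j}. ?\<psi> ((T' ^^ j) z) = (T ^^ R) (?\<psi> z)" if z: "z \<in> generic \<theta>'" for j z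
  proof (induction j)
    case (Suc j)
    then obtain R where R: "R \<in> {j..3 * j}" "?\<psi> ((T' ^^ j) z) = (T ^^ R) (?\<psi> z)" by blast
    obtain r where r: "r \<in> {1..3}" "?\<psi> (T' ((T' ^^ j) z)) = (T ^^ r) (?\<psi> ((T' ^^ j) z))"
      using ret[OF gen'[OF z]] by blast
    have "?\<psi> ((T' ^^ Suc j) z) = (T ^^ (r + R)) (?\<psi> z)"
      using r(2) R(2) by (simp add: funpow_add)
    then show ?case using R(1) r(1) by (intro bexI[of _ "r + R"]) auto
  qed simp
  have sub1: "?\<psi> ` nonper (\<theta>', \<epsilon>') n \<subseteq> nonper (\<theta>, \<epsilon>) n" for n
  proof (rule image_subsetI)
    fix z assume "z \<in> nonper (\<theta>', \<epsilon>') n"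
    then have z: "z \<in> generic \<theta>'" and np: "\<And>q. q \<in> {1..n} \<Longrightarrow> (T' ^^ q) z \<noteq> z"
      by (auto simp: nonper_def T'_def)
    have "(T ^^ q) (?\<psi> z) \<noteq> ?\<psi> z" if q: "q \<in> {1..n}" for q
    proof
      assume eq: "(T ^^ q) (?\<psi> z) = ?\<psi> z"
      \<comment> \<open>Pigeonhole: these n + 1 points lie on a T-orbit with at most q \<le> n
        points. Two of them coincide, and injectivity of T' cancels the common initial
        segment.\<close>
      let ?f = "\<lambda>j. ?\<psi> ((T' ^^ j) z)"
      have "?f ` {0..n} \<subseteq> (\<lambda>m. (T ^^ m) (?\<psi> z)) ` {..<q}"
      proof (rule image_subsetI)
        fix j
        obtain R where R: "?f j = (T ^^ R) (?\<psi> z)" using iter[OF z] by blast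
        also have "\<dots> = (T ^^ (R mod q)) (?\<psi> z)"
          using funpow_mod_eq[where f = T and n = q and x = "?\<psi> z" and m = R] eq by simp
        finally show "?f j \<in> (\<lambda>m. (T ^^ m) (?\<psi> z)) ` {..<q}" using q by auto
      qed
      then have "card (?f ` {0..n}) \<le> card {..<q}"
        by (intro surj_card_le) auto
      also have "\<dots> < card {0..n}" using q by simp
      finally have "\<not> inj_on ?f {0..n}" by (rule pigeonhole)
      then obtain i j where ij: "i < j" "j \<le> n" "?f i = ?f j"
        unfolding inj_on_def by (metis atLeastAtMost_iff nat_neq_iff)
      then have "(T' ^^ i) z = (T' ^^ (i + (j - i))) z" using inj[OF g0] by simp
      then have "(T' ^^ i) z = (T' ^^ i) ((T' ^^ (j - i)) z)" by (simp only: funpow_add comp_apply)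
      then have "z = (T' ^^ (j - i)) z"
        by (rule inj_onD[OF inj_on_mapT_pow_generic[OF pos(2), where \<epsilon> = \<epsilon>' and n = i, folded T'_def]])
          (use z gen'[OF z] in auto)
      then show False using np[of "j - i"] ij(1,2) by (metis (full_types) Suc_leI One_nat_def atLeastAtMost_iff diff_le_self le_trans zero_less_diff)
    qed
    then show "?\<psi> z \<in> nonper (\<theta>, \<epsilon>) n"
      using gen[OF z] by (simp add: nonper_def T_def)
  qed
  \<comment> \<open>A period q of w becomes a period of z of at most 3q; the summand 8 excludes the
    left-over points that never meet the induced domain.\<close>
  have sub2: "nonper (\<theta>, \<epsilon>) (3 * n + 8) \<subseteq> (\<Union>g\<in>H. (\<lambda>z. g (c *\<^sub>R z)) ` nonper (\<theta>', \<epsilon>') n)" for n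
  proof
    fix z assume "z \<in> nonper (\<theta>, \<epsilon>) (3 * n + 8)"
    then have z: "z \<in> generic \<theta>" and np: "\<And>q. q \<in> {1..3 * n + 8} \<Longrightarrow> (T ^^ q) z \<noteq> z"
      by (auto simp: nonper_def T_def)
    have "\<not> (\<exists>q\<in>{1..8}. (T ^^ q) z = z)" using np by auto
    then obtain g k w where w: "g \<in> H" "w \<in> generic \<theta>'" "z = g (c *\<^sub>R w)" "z = (T ^^ k) (?\<psi> w)"
      using cover[OF z] by blast
    have "(T' ^^ q) w \<noteq> w" if q: "q \<in> {1..n}" for q
    proof
      assume "(T' ^^ q) w = w"
      then obtain R where R: "R \<in> {q..3 * q}" "?\<psi> w = (T ^^ R) (?\<psi> w)"
        using iter[OF w(2), of q] by auto
      have "(T ^^ R) z = (T ^^ (k + R)) (?\<psi> w)"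
        unfolding w(4) by (metis add.commute comp_apply funpow_add)
      also have "\<dots> = (T ^^ k) ((T ^^ R) (?\<psi> w))" by (simp add: funpow_add)
      also have "\<dots> = z" using R(2) w(4) by simp
      finally show False using np[of R] R(1) q by auto
    qed
    then have "w \<in> nonper (\<theta>', \<epsilon>') n" using w(2) by (simp add: nonper_def T'_def)
    then show "z \<in> (\<Union>g\<in>H. (\<lambda>z. g (c *\<^sub>R z)) ` nonper (\<theta>', \<epsilon>') n)" using w by blast
  qed
  show "?\<psi> ` aperiodicK (\<theta>', \<epsilon>') \<subseteq> aperiodicK (\<theta>, \<epsilon>)"
  proof -
    have "?\<psi> ` closure (nonper (\<theta>', \<epsilon>') n) \<subseteq> closure (nonper (\<theta>, \<epsilon>) n)" for n
      by (rule image_closure_subset[OF cont[OF g0]])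
        (use closure_subset sub1 in \<open>blast | simp\<close>)+
    then show ?thesis by (auto simp: aperiodicK_eq pos)
  qed
  show "aperiodicK (\<theta>, \<epsilon>) \<subseteq> (\<Union>g\<in>H. (\<lambda>z. g (c *\<^sub>R z)) ` aperiodicK (\<theta>', \<epsilon>'))"
  proof
    fix z assume z: "z \<in> aperiodicK (\<theta>, \<epsilon>)"
    let ?C = "\<lambda>g n. (\<lambda>z. g (c *\<^sub>R z)) ` closure (nonper (\<theta>', \<epsilon>') n)"
    have mem: "z \<in> (\<Union>g\<in>H. ?C g n)" for n
    proof -
      have "closed (\<Union>g\<in>H. ?C g n)"
        by (intro closed_UN H(1) ballI compact_imp_closed compact_continuous_image
            cont compact_closure_nonper H(2))
      moreover have "nonper (\<theta>, \<epsilon>) (3 * n + 8) \<subseteq> (\<Union>g\<in>H. ?C g n)"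
        using sub2[of n] by (rule order_trans) (intro UN_mono image_mono closure_subset order_refl)
      ultimately have "closure (nonper (\<theta>, \<epsilon>) (3 * n + 8)) \<subseteq> (\<Union>g\<in>H. ?C g n)"
        by (rule closure_minimal[rotated])
      moreover have "z \<in> closure (nonper (\<theta>, \<epsilon>) (3 * n + 8))"
        using z by (simp add: aperiodicK_eq pos)
      ultimately show ?thesis by (rule subsetD)
    qed
    \<comment> \<open>So far g may depend on n. Since H is finite and the sets decrease with n, one
      g serves all levels; its injectivity then gives one preimage for all levels.\<close>
    have "\<exists>g\<in>H. \<forall>n. z \<in> ?C g n"
    proof (rule ccontr)
      assume "\<not> ?thesis"
      then obtain N where N: "\<And>g. g \<in> H \<Longrightarrow> z \<notin> ?C g (N g)" by metis
      define M where "M = Max (N ` H)"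
      obtain g where g: "g \<in> H" "z \<in> ?C g M" using mem by blast
      have "N g \<le> M" using g(1) H(1) by (simp add: M_def)
      then have "?C g M \<subseteq> ?C g (N g)" by (intro image_mono closure_mono nonper_antimono)
      then show False using N g by blast
    qed
    then obtain g where g: "g \<in> H" "\<And>n. z \<in> ?C g n" by blast
    then obtain y where y: "z = g (c *\<^sub>R y)" by blast
    have "y \<in> closure (nonper (\<theta>', \<epsilon>') n)" for n
    proof -
      obtain w where "w \<in> closure (nonper (\<theta>', \<epsilon>') n)" "z = g (c *\<^sub>R w)" using g(2)[of n] by blast
      then show ?thesis using y inj[OF H(2)[OF g(1)], of y w] by simp
    qed
    then show "z \<in> (\<Union>g\<in>H. (\<lambda>z. g (c *\<^sub>R z)) ` aperiodicK (\<theta>', \<epsilon>'))"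
      using g(1) y by (auto simp: aperiodicK_eq pos)
  qed
qed

lemma cover_null_induced:
  assumes "s > 0"
  shows "cover_null s (aperiodicK (\<theta>, \<epsilon>)) \<longleftrightarrow> cover_null s (aperiodicK (\<theta>', \<epsilon>'))"
proof
  assume *: "cover_null s (aperiodicK (\<theta>, \<epsilon>))"
  let ?\<psi> = "\<lambda>z. g0 (c *\<^sub>R z)"
  have inj: "inj ?\<psi>"
    using dist_similarity[OF g0] pos(3) by (intro injI) (metis dist_eq_0_iff mult_eq_0_iff less_irrefl)
  have "cover_null s (inv ?\<psi> ` ?\<psi> ` aperiodicK (\<theta>', \<epsilon>'))"
  proof (rule cover_null_image[where L = "1 / c"])
    show "cover_null s (?\<psi> ` aperiodicK (\<theta>', \<epsilon>'))"
      by (rule cover_null_subset[OF * aperiodicK_induced(1)])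
    show "dist (inv ?\<psi> x) (inv ?\<psi> y) \<le> 1 / c * dist x y"
      if "x \<in> ?\<psi> ` aperiodicK (\<theta>', \<epsilon>')" "y \<in> ?\<psi> ` aperiodicK (\<theta>', \<epsilon>')" for x y
      using that pos(3) dist_similarity[OF g0] inv_f_f[OF inj] by auto
  qed (use pos assms in auto)
  then show "cover_null s (aperiodicK (\<theta>', \<epsilon>'))" by (simp add: image_image inv_f_f[OF inj])
next
  assume *: "cover_null s (aperiodicK (\<theta>', \<epsilon>'))"
  have "cover_null s (\<Union>g\<in>H. (\<lambda>z. g (c *\<^sub>R z)) ` aperiodicK (\<theta>', \<epsilon>'))"
    using assms H pos(3) dist_similarity
    by (intro cover_null_finite_UN) (auto intro!: cover_null_image[OF *, of c])
  then show "cover_null s (aperiodicK (\<theta>, \<epsilon>))"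
    by (rule cover_null_subset[OF _ aperiodicK_induced(2)])
qed

end

section \<open>The three renormalizations\<close>

lemma lattice_of_int_mult: "x \<in> lattice \<theta> \<Longrightarrow> of_int m * x \<in> lattice \<theta>"
proof -
  assume "x \<in> lattice \<theta>"
  then obtain a b where "x = of_int a + of_int b * \<theta>"
    unfolding lattice_def by blast
  then have "of_int m * x = of_int (m * a) + of_int (m * b) * \<theta>" by (simp add: algebra_simps)
  then show ?thesis unfolding lattice_def by blast
qed

text \<open>The hypotheses place the generators of each lattice in the suitably scaled other
  lattice, so scaling by c identifies the two. This is what makes generic points correspond to
  generic points.\<close>

lemma lattice_scale:
  assumes "c \<noteq> 0" "u \<in> lattice \<theta>'" "c * u = 1" "v \<in> lattice \<theta>'" "c * v = \<theta>"
    "c \<in> lattice \<theta>" "c * \<theta>' \<in> lattice \<theta>"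
  shows "c * x \<in> lattice \<theta> \<longleftrightarrow> x \<in> lattice \<theta>'"
proof
  assume "c * x \<in> lattice \<theta>"
  then obtain a b :: int where "c * x = a + b * \<theta>" unfolding lattice_def by blast
  also have "\<dots> = a * (c * u) + b * (c * v)" using assms(3,5) by simp
  also have "\<dots> = c * (a * u + b * v)" by (simp add: algebra_simps)
  finally have "x = a * u + b * v" using assms(1) by simp
  then show "x \<in> lattice \<theta>'" using assms by (simp add: lattice_add lattice_of_int_mult)
next
  assume "x \<in> lattice \<theta>'"
  then obtain a b :: int where "x = a + b * \<theta>'" unfolding lattice_def by blast
  then have "c * x = a * c + b * (c * \<theta>')" by (simp add: algebra_simps)
  then show "c * x \<in> lattice \<theta>" using assms by (simp add: lattice_add lattice_of_int_mult)
qed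

lemma genericI:
  "0 < x \<Longrightarrow> x < 1 + \<theta> \<Longrightarrow> 0 < y \<Longrightarrow> y < 1 \<Longrightarrow> x \<notin> lattice \<theta> \<Longrightarrow> y \<notin> lattice \<theta> \<Longrightarrow> (x, y) \<in> generic \<theta>"
  by (simp add: generic_def)

lemma genericI_div:
  assumes "c > 0" "\<And>x. c * x \<in> lattice \<theta> \<longleftrightarrow> x \<in> lattice \<theta>'"
    "0 < x" "x < c * (1 + \<theta>')" "0 < y" "y < c" "x \<notin> lattice \<theta>" "y \<notin> lattice \<theta>"
  shows "(x / c, y / c) \<in> generic \<theta>'"
  using assms(1,3-8) assms(2)[of "x / c"] assms(2)[of "y / c"]
  by (intro genericI) (auto simp: field_simps)

lemma quarter_map_corner: "quarter_map (\<lambda>z. (1 + snd z, 1 - fst z))"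
  by (rule quarter_mapI2[of 1 "-1" _ 1 1]) auto

lemma quarter_map_translation: "quarter_map (\<lambda>z. (\<theta> + fst z, snd z))"
  by (rule quarter_mapI1[of 1 1 _ \<theta> 0]) auto

text \<open>The induced domain is the rectangle R, turned by a right angle: its sides 1 and \<theta>
  become 1/\<theta> = 1 + \<theta>' and 1 after scaling. Orbits starting in R return after 2 or 3
  steps. What they miss is the square (\<theta>,1) x (\<theta>,1), on which T is a quarter turn
  about the centre, so its points are fixed by the fourth iterate.\<close>

lemma cover_null_renorm_rotation:
  assumes \<theta>: "0 < \<theta>" "\<theta> < 1" and "s > 0"
  shows "cover_null s (aperiodicK (\<theta>, -1)) \<longleftrightarrow> cover_null s (aperiodicK (1 / \<theta> - 1, 1))"
proof -
  let ?T = "mapT (\<theta>, -1)" and ?\<theta>' = "1 / \<theta> - 1"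
  define g0 :: "point \<Rightarrow> point" where "g0 = (\<lambda>z. (1 + snd z, 1 - fst z))"
  define g1 where "g1 = piece_map (\<theta>, -1) Lb \<circ> g0"
  define g2 where "g2 = piece_map (\<theta>, -1) La \<circ> g1"
  have L: "\<theta> * x \<in> lattice \<theta> \<longleftrightarrow> x \<in> lattice ?\<theta>'" for x
    by (rule lattice_scale[OF _ lattice_1_add_self _ lattice_1]) (use \<theta> in \<open>simp_all add: right_diff_distrib\<close>)
  have mC: "?T (x, y) = (1 + \<theta> - y, x)" if "0 < x" "x < 1" "0 < y" "y < 1" for x y
    using that by (simp add: mapT_C flip_def)
  have mR: "?T (x, y) = (x - 1, 1 - y)" if "1 < x" "x < 1 + \<theta>" "0 < y" "y < 1" for x y
    using that by (simp add: mapT_R)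
  interpret induced_map \<theta> ?\<theta>' \<theta> "-1" 1 g0 "{g0, g1, g2}"
  proof
    show "quarter_map g0" unfolding g0_def by (rule quarter_map_corner)
    then show "quarter_map g" if "g \<in> {g0, g1, g2}" for g
      using that by (auto simp only: g1_def g2_def insert_iff empty_iff intro: quarter_map_comp quarter_map_piece_map)
    show "g0 (\<theta> *\<^sub>R z) \<in> generic \<theta>" if z: "z \<in> generic ?\<theta>'" for z
    proof (cases z)
      case (Pair X Y)
      note g = genericD[OF z[unfolded Pair]]
      have "\<theta> * X < 1" "\<theta> * Y < \<theta>" using g \<theta> by (simp_all add: field_simps)
      then show ?thesis using g \<theta> L by (simp add: Pair g0_def generic_def add_pos_pos)
    qed
    show "\<exists>r\<in>{1..3}. g0 (\<theta> *\<^sub>R mapT (?\<theta>', 1) z) = (?T ^^ r) (g0 (\<theta> *\<^sub>R z))" if z: "z \<in> generic ?\<theta>'" for z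
    proof (cases z)
      case (Pair X Y)
      note g = genericD[OF z[unfolded Pair]]
      have b: "0 < \<theta> * X" "\<theta> * X < 1" "0 < \<theta> * Y" "\<theta> * Y < \<theta>" using g \<theta> by (simp_all add: field_simps)
      have b': "\<theta> * Y < 1" using b(4) \<theta>(2) by (rule less_trans)
      have 1: "?T (g0 (\<theta> *\<^sub>R z)) = (\<theta> * Y, \<theta> * X)"
        using b \<theta> by (simp add: Pair g0_def mR)
      have 2: "?T (\<theta> * Y, \<theta> * X) = (1 + \<theta> - \<theta> * X, \<theta> * Y)"
        using b b' by (simp add: mC)
      show ?thesis
      proof (cases "X < 1")
        case True
        have "g0 (\<theta> *\<^sub>R mapT (?\<theta>', 1) z) = (?T ^^ 2) (g0 (\<theta> *\<^sub>R z))"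
          using True g \<theta> by (simp add: eval_nat_numeral 1 2) (simp add: Pair mapT_C g0_def flip_def algebra_simps)
        then show ?thesis by (intro bexI[of _ 2]) auto
      next
        case False
        then have X: "X > 1" using g by auto
        have "?T (1 + \<theta> - \<theta> * X, \<theta> * Y) = (1 + \<theta> - \<theta> * Y, 1 + \<theta> - \<theta> * X)"
          using X b b' by (intro mC) auto
        then have "g0 (\<theta> *\<^sub>R mapT (?\<theta>', 1) z) = (?T ^^ 3) (g0 (\<theta> *\<^sub>R z))"
          using X g \<theta> by (simp add: eval_nat_numeral 1 2) (simp add: Pair mapT_R g0_def algebra_simps)
        then show ?thesis by (intro bexI[of _ 3]) auto
      qed
    qed
    show "(\<exists>q\<in>{1..8}. (?T ^^ q) z = z) \<or>
      (\<exists>g\<in>{g0, g1, g2}. \<exists>k. \<exists>w\<in>generic ?\<theta>'. z = g (\<theta> *\<^sub>R w) \<and> z = (?T ^^ k) (g0 (\<theta> *\<^sub>R w)))"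
      if z: "z \<in> generic \<theta>" for z
    proof (cases z)
      case (Pair x y)
      note g = genericD[OF z[unfolded Pair]]
      have D: "(p / \<theta>, q / \<theta>) \<in> generic ?\<theta>'"
        if "0 < p" "p < 1" "0 < q" "q < \<theta>" "p \<notin> lattice \<theta>" "q \<notin> lattice \<theta>" for p q
        by (rule genericI_div[OF \<theta>(1) L]) (use that \<theta> in auto)
      have v: "g0 (\<theta> *\<^sub>R (p / \<theta>, q / \<theta>)) = (1 + q, 1 - p)" "g1 (\<theta> *\<^sub>R (p / \<theta>, q / \<theta>)) = (q, p)"
        "g2 (\<theta> *\<^sub>R (p / \<theta>, q / \<theta>)) = (1 + \<theta> - p, q)" for p q
        using \<theta> by (simp_all add: g0_def g1_def g2_def piece_map_def flip_def)
      \<comment> \<open>The first two regions are R and its image; the third holds the points of the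
        second image that have not yet returned to R; the fourth is the rotating square.\<close>
      consider "x > 1" | "x < \<theta>" | "\<theta> < x" "x < 1" "y < \<theta>" | "\<theta> < x" "x < 1" "\<theta> < y"
        using g by linarith
      then show ?thesis
      proof cases
        case 1
        have "z = g0 (\<theta> *\<^sub>R ((1 - y) / \<theta>, (x - 1) / \<theta>))" unfolding v Pair by simp
        moreover have "((1 - y) / \<theta>, (x - 1) / \<theta>) \<in> generic ?\<theta>'" using 1 g by (intro D) auto
        ultimately show ?thesis by (metis funpow_0 insertI1)
      next
        case 2
        have "z = g1 (\<theta> *\<^sub>R (y / \<theta>, x / \<theta>))" unfolding v Pair by simp
        moreover have "z = (?T ^^ 1) (g0 (\<theta> *\<^sub>R (y / \<theta>, x / \<theta>)))"
          unfolding v Pair using 2 g by (simp add: mR)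
        moreover have "(y / \<theta>, x / \<theta>) \<in> generic ?\<theta>'" using 2 g by (intro D) auto
        ultimately show ?thesis by blast
      next
        case 3
        have "z = g2 (\<theta> *\<^sub>R ((1 + \<theta> - x) / \<theta>, y / \<theta>))" unfolding v Pair by simp
        moreover have "z = (?T ^^ 2) (g0 (\<theta> *\<^sub>R ((1 + \<theta> - x) / \<theta>, y / \<theta>)))"
          unfolding v Pair using 3 g \<theta> by (simp add: eval_nat_numeral mR mC)
        moreover have "((1 + \<theta> - x) / \<theta>, y / \<theta>) \<in> generic ?\<theta>'" using 3 g by (intro D) auto
        ultimately show ?thesis by blast
      next
        case 4
        then have "(?T ^^ 4) z = z" using g \<theta> by (simp add: Pair eval_nat_numeral mC)
        then show ?thesis by (intro disjI1 bexI[of _ 4]) auto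
      qed
    qed
  qed (use \<theta> in auto)
  show ?thesis by (rule cover_null_induced[OF \<open>s > 0\<close>])
qed

text \<open>The induced domain is (\<theta>, 1 + \<theta>) x (0, 1 - \<theta>), whose sides 1 and 1
  - \<theta> have the ratio 1 + \<theta>'. Points of it in the square return at once, the others
  after 3 steps. The squares (0,\<theta>) x (0,\<theta>) and (1, 1 + \<theta>) x (1 - \<theta>, 1)
  are left over: T exchanges them and its square is a quarter turn on each, hence the exponent
  8.\<close>

lemma cover_null_renorm_reflection:
  assumes \<theta>: "0 < \<theta>" "\<theta> < 1" and "s > 0"
  shows "cover_null s (aperiodicK (\<theta>, 1)) \<longleftrightarrow> cover_null s (aperiodicK (\<theta> / (1 - \<theta>), 1))"
proof -
  let ?T = "mapT (\<theta>, 1)" and ?\<theta>' = "\<theta> / (1 - \<theta>)"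
  define c where "c = 1 - \<theta>"
  define g0 :: "point \<Rightarrow> point" where "g0 = (\<lambda>z. (\<theta> + fst z, snd z))"
  define g1 where "g1 = piece_map (\<theta>, 1) Lb \<circ> g0"
  define g2 where "g2 = piece_map (\<theta>, 1) La \<circ> g1"
  have c: "c > 0" "c * (1 + ?\<theta>') = 1" "c * ?\<theta>' = \<theta>" using \<theta> by (simp_all add: c_def field_simps)
  have L: "c * x \<in> lattice \<theta> \<longleftrightarrow> x \<in> lattice ?\<theta>'" for x
    by (rule lattice_scale[of _ "1 + ?\<theta>'" _ ?\<theta>']) (use c in \<open>auto simp: c_def\<close>)
  have mC: "?T (x, y) = (1 + \<theta> - y, 1 - x)" if "0 < x" "x < 1" "0 < y" "y < 1" for x y
    using that by (simp add: mapT_C flip_def)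
  have mR: "?T (x, y) = (x - 1, 1 - y)" if "1 < x" "x < 1 + \<theta>" "0 < y" "y < 1" for x y
    using that by (simp add: mapT_R)
  interpret induced_map \<theta> ?\<theta>' c 1 1 g0 "{g0, g1, g2}"
  proof
    show "quarter_map g0" unfolding g0_def by (rule quarter_map_translation)
    then show "quarter_map g" if "g \<in> {g0, g1, g2}" for g
      using that by (auto simp only: g1_def g2_def insert_iff empty_iff intro: quarter_map_comp quarter_map_piece_map)
    show gen: "g0 (c *\<^sub>R z) \<in> generic \<theta>" if z: "z \<in> generic ?\<theta>'" for z
    proof (cases z)
      case (Pair X Y)
      note g = genericD[OF z[unfolded Pair]]
      have "c * X < c * (1 + ?\<theta>')" "c * Y < c * 1" using g c(1) by (simp_all only: mult_less_cancel_left_pos)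
      then have "c * X < 1" "c * Y < 1 - \<theta>" unfolding c(2) by (simp_all add: c_def)
      then show ?thesis using g \<theta> L c by (simp add: Pair g0_def generic_def add_pos_pos)
    qed
    show "\<exists>r\<in>{1..3}. g0 (c *\<^sub>R mapT (?\<theta>', 1) z) = (?T ^^ r) (g0 (c *\<^sub>R z))" if z: "z \<in> generic ?\<theta>'" for z
    proof (cases z)
      case (Pair X Y)
      note g = genericD[OF z[unfolded Pair]]
      have "c * X < c * (1 + ?\<theta>')" "c * Y < c * 1" using g c(1) by (simp_all only: mult_less_cancel_left_pos)
      then have b: "0 < c * X" "c * X < 1" "0 < c * Y" "c * Y < 1 - \<theta>"
        unfolding c(2) using g c(1) by (simp_all add: c_def)
      show ?thesis
      proof (cases "X < 1")
        case True
        then have "c * X < c * 1" using c(1) by (simp only: mult_less_cancel_left_pos)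
        then have "c * X < 1 - \<theta>" by (simp add: c_def)
        then have "?T (g0 (c *\<^sub>R z)) = (1 + \<theta> - c * Y, 1 - (\<theta> + c * X))"
          using b \<theta> by (simp add: Pair g0_def mC)
        moreover have "mapT (?\<theta>', 1) z = (1 + ?\<theta>' - Y, 1 - X)"
          using True g by (simp add: Pair mapT_C flip_def)
        moreover have "c * (1 + ?\<theta>' - Y) = 1 - c * Y" "c * (1 - X) = 1 - (\<theta> + c * X)"
          using c(2) by (simp_all add: algebra_simps, simp add: c_def algebra_simps)
        ultimately have "g0 (c *\<^sub>R mapT (?\<theta>', 1) z) = (?T ^^ 1) (g0 (c *\<^sub>R z))"
          by (simp add: g0_def)
        then show ?thesis by (intro bexI[of _ 1]) auto
      next
        case False
        then have X: "X > 1" using g by auto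
        then have "c * 1 < c * X" using c(1) by (simp only: mult_less_cancel_left_pos)
        then have b': "c * X > 1 - \<theta>" by (simp add: c_def)
        have 1: "?T (g0 (c *\<^sub>R z)) = (\<theta> + c * X - 1, 1 - c * Y)"
          using b b' \<theta> by (simp add: Pair g0_def mR)
        have 2: "?T (\<theta> + c * X - 1, 1 - c * Y) = (\<theta> + c * Y, 2 - \<theta> - c * X)"
          using b b' \<theta> by (simp add: mC)
        have 3: "?T (\<theta> + c * Y, 2 - \<theta> - c * X) = (2 * \<theta> - 1 + c * X, 1 - \<theta> - c * Y)"
          using b b' \<theta> by (simp add: mC)
        have "g0 (c *\<^sub>R mapT (?\<theta>', 1) z) = (?T ^^ 3) (g0 (c *\<^sub>R z))"
          using X g by (simp add: eval_nat_numeral 1 2 3) (simp add: Pair mapT_R g0_def c_def algebra_simps)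
        then show ?thesis by (intro bexI[of _ 3]) auto
      qed
    qed
    show "(\<exists>q\<in>{1..8}. (?T ^^ q) z = z) \<or>
      (\<exists>g\<in>{g0, g1, g2}. \<exists>k. \<exists>w\<in>generic ?\<theta>'. z = g (c *\<^sub>R w) \<and> z = (?T ^^ k) (g0 (c *\<^sub>R w)))"
      if z: "z \<in> generic \<theta>" for z
    proof (cases z)
      case (Pair x y)
      note g = genericD[OF z[unfolded Pair]]
      have D: "(p / c, q / c) \<in> generic ?\<theta>'"
        if "0 < p" "p < 1" "0 < q" "q < 1 - \<theta>" "p \<notin> lattice \<theta>" "q \<notin> lattice \<theta>" for p q
        by (rule genericI_div[OF c(1) L]) (use that c(2) in \<open>auto simp: c_def\<close>)
      have v: "g0 (c *\<^sub>R (p / c, q / c)) = (\<theta> + p, q)" "g1 (c *\<^sub>R (p / c, q / c)) = (\<theta> + p - 1, 1 - q)"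
        "g2 (c *\<^sub>R (p / c, q / c)) = (\<theta> + q, 2 - \<theta> - p)" for p q
        using c(1) by (simp_all add: g0_def g1_def g2_def piece_map_def flip_def)
      have two: "2 \<in> lattice \<theta>" using lattice_add[OF lattice_1 lattice_1, of \<theta>] by simp
      \<comment> \<open>The first three regions are the induced domain and the two intermediate
        stops of its points with return time 3; the last two are the exchanged squares.\<close>
      consider "x > \<theta>" "y < 1 - \<theta>" | "x < \<theta>" "y > \<theta>" | "\<theta> < x" "x < 1" "1 - \<theta> < y"
        | "x < \<theta>" "y < \<theta>" | "1 < x" "1 - \<theta> < y"
        using g by linarith
      then show ?thesis
      proof cases
        case 1
        have "z = g0 (c *\<^sub>R ((x - \<theta>) / c, y / c))" unfolding v Pair by simp
        moreover have "((x - \<theta>) / c, y / c) \<in> generic ?\<theta>'" using 1 g by (intro D) auto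
        ultimately show ?thesis by (metis funpow_0 insertI1)
      next
        case 2
        let ?w = "((x + (1 - \<theta>)) / c, (1 - y) / c)"
        have "z = g1 (c *\<^sub>R ?w)" unfolding v Pair by simp
        moreover have "z = (?T ^^ 1) (g0 (c *\<^sub>R ?w))"
          unfolding v Pair using 2 g by (simp add: mR)
        moreover have "?w \<in> generic ?\<theta>'" using 2 g \<theta> by (intro D) auto
        ultimately show ?thesis by blast
      next
        case 3
        let ?w = "((2 - \<theta> - y) / c, (x - \<theta>) / c)"
        have "z = g2 (c *\<^sub>R ?w)" unfolding v Pair by simp
        moreover have "z = (?T ^^ 2) (g0 (c *\<^sub>R ?w))"
          unfolding v Pair using 3 g \<theta> by (simp add: eval_nat_numeral mR mC)
        moreover have "?w \<in> generic ?\<theta>'" using 3 g two by (intro D) auto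
        ultimately show ?thesis by blast
      next
        case 4
        then have "(?T ^^ 8) z = z" using g \<theta> by (simp add: Pair eval_nat_numeral mC mR)
        then show ?thesis by (intro disjI1 bexI[of _ 8]) auto
      next
        case 5
        then have "(?T ^^ 8) z = z" using g \<theta> by (simp add: Pair eval_nat_numeral mC mR)
        then show ?thesis by (intro disjI1 bexI[of _ 8]) auto
      qed
    qed
  qed (use \<theta> c in auto)
  show ?thesis by (rule cover_null_induced[OF \<open>s > 0\<close>])
qed

text \<open>Inducing here means skipping the last unit square (\<theta>, 1 + \<theta>) x (0,1). It
  is exactly the image of the square C, up to boundaries, and for \<theta> > 1 it lies in R, so a
  visit costs one extra step. That step turns y into 1 - y, which reverses the sign. No periodic
  points are left over.\<close>

lemma cover_null_renorm_subtract:
  assumes \<theta>: "\<theta> > 1" and "s > 0" and \<epsilon>: "\<epsilon> \<in> {-1, 1}"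
  shows "cover_null s (aperiodicK (\<theta>, \<epsilon>)) \<longleftrightarrow> cover_null s (aperiodicK (\<theta> - 1, - \<epsilon>))"
proof -
  let ?T = "mapT (\<theta>, \<epsilon>)" and ?\<theta>' = "\<theta> - 1"
  define g1 where "g1 = piece_map (\<theta>, \<epsilon>) La"
  have L: "1 * x \<in> lattice \<theta> \<longleftrightarrow> x \<in> lattice ?\<theta>'" for x
    by (rule lattice_scale[OF _ lattice_1 _ lattice_1_add_self]) simp_all
  have mC: "?T (x, y) = (1 + \<theta> - y, flip \<epsilon> x)" if "0 < x" "x < 1" "0 < y" "y < 1" for x y
    using that by (simp add: mapT_C)
  have mR: "?T (x, y) = (x - 1, 1 - y)" if "1 < x" "x < 1 + \<theta>" "0 < y" "y < 1" for x y
    using that by (simp add: mapT_R)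
  interpret induced_map \<theta> ?\<theta>' 1 \<epsilon> "- \<epsilon>" id "{id, g1}"
  proof
    show "quarter_map id" by (rule quarter_map_id)
    then show "quarter_map g" if "g \<in> {id, g1}" for g
      using that by (auto simp only: g1_def insert_iff empty_iff intro: quarter_map_piece_map)
    show "id (1 *\<^sub>R z) \<in> generic \<theta>" if "z \<in> generic ?\<theta>'" for z
      using that L[of "fst z"] L[of "snd z"] by (simp add: generic_def)
    show "\<exists>r\<in>{1..3}. id (1 *\<^sub>R mapT (?\<theta>', - \<epsilon>) z) = (?T ^^ r) (id (1 *\<^sub>R z))" if z: "z \<in> generic ?\<theta>'" for z
    proof (cases z)
      case (Pair x y)
      note g = genericD[OF z[unfolded Pair]]
      show ?thesis
      proof (cases "x < 1")
        case True
        have "mapT (?\<theta>', - \<epsilon>) z = (?T ^^ 2) z"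
          using True g \<theta> \<epsilon> flip_pos_iff[of x \<epsilon>]
          by (simp add: eval_nat_numeral Pair mC mR mapT_C) (auto simp: flip_def)
        then show ?thesis by (intro bexI[of _ 2]) auto
      next
        case False
        then have X: "x > 1" using g by auto
        have "mapT (?\<theta>', - \<epsilon>) z = (?T ^^ 1) z"
          using X g by (simp add: Pair mR mapT_R)
        then show ?thesis by (intro bexI[of _ 1]) auto
      qed
    qed
    show "(\<exists>q\<in>{1..8}. (?T ^^ q) z = z) \<or>
      (\<exists>g\<in>{id, g1}. \<exists>k. \<exists>w\<in>generic ?\<theta>'. z = g (1 *\<^sub>R w) \<and> z = (?T ^^ k) (id (1 *\<^sub>R w)))"
      if z: "z \<in> generic \<theta>" for z
    proof (cases z)
      case (Pair x y)
      note g = genericD[OF z[unfolded Pair]]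
      show ?thesis
      proof (cases "x < \<theta>")
        case True
        then have "z \<in> generic ?\<theta>'" using g L[of x] L[of y] by (simp add: Pair generic_def)
        then show ?thesis by (metis funpow_0 id_apply insertI1 scaleR_one)
      next
        case False
        then have x: "x > \<theta>" using g by auto
        let ?w = "(flip \<epsilon> y, 1 + \<theta> - x)"
        have "z = g1 (1 *\<^sub>R ?w)" by (simp add: g1_def piece_map_def Pair)
        moreover have "z = (?T ^^ 1) (id (1 *\<^sub>R ?w))"
          using x g flip_pos_iff[of y \<epsilon>] by (simp add: mC Pair)
        moreover have "?w \<in> generic ?\<theta>'"
        proof (rule genericI)
          have l: "p \<in> lattice ?\<theta>' \<longleftrightarrow> p \<in> lattice \<theta>" for p using L[of p] by simp
          show "flip \<epsilon> y \<notin> lattice ?\<theta>'" "1 + \<theta> - x \<notin> lattice ?\<theta>'"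
            unfolding l using g by auto
        qed (use x g \<theta> flip_pos_iff[of y \<epsilon>] in auto)
        ultimately show ?thesis by blast
      qed
    qed
  qed (use \<theta> in auto)
  show ?thesis by (rule cover_null_induced[OF \<open>s > 0\<close>])
qed

section \<open>A zero-one law for extensions of the Gauss map\<close>

text \<open>The inverse branch of an iterate of the Gauss map that prepends the partial quotients in
  the word to those of t.\<close>

fun cf_branch :: "nat list \<Rightarrow> real \<Rightarrow> real" where
  "cf_branch [] t = t"
| "cf_branch (k # w) t = 1 / (real k + cf_branch w t)"

abbreviation cf_word :: "nat list \<Rightarrow> bool" where
  "cf_word w \<equiv> (\<forall>k\<in>set w. k \<ge> 1)"

lemma inverse_shift_bounds:
  fixes t :: real
  assumes "k \<ge> (1::nat)" "0 < t" "t < 1"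
  shows "0 < 1 / (real k + t)" "1 / (real k + t) < 1"
proof -
  have "real k \<ge> 1" using assms(1) by simp
  then show "0 < 1 / (real k + t)" "1 / (real k + t) < 1"
    using assms(2,3) by (simp_all add: field_simps)
qed

lemma cf_branch_bounds:
  "cf_word w \<Longrightarrow> 0 < t \<Longrightarrow> t < 1 \<Longrightarrow> 0 < cf_branch w t \<and> cf_branch w t < 1"
proof (induction w)
  case (Cons k w)
  then show ?case using inverse_shift_bounds[of k "cf_branch w t"] by simp
qed simp

text \<open>In the usual notation \<open>c\<close> and \<open>d\<close> are the denominators of the last two convergents.
  The inequalities between \<open>a + c\<close> and \<open>b + d\<close> make \<open>d \<le> c\<close> inductive.\<close>

lemma cf_branch_mobius:
  assumes "cf_word w"
  obtains a b c d :: real where "c \<ge> 1" "0 \<le> d" "d \<le> c" "\<bar>b * c - a * d\<bar> = 1" "2 * c \<ge> real (length w)"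
    "\<And>t. 0 \<le> t \<Longrightarrow> cf_branch w t = (a + b * t) / (c + d * t)"
proof -
  have "\<exists>a b c d :: real. a \<ge> 0 \<and> b \<ge> 0 \<and> c \<ge> 1 \<and> 0 \<le> d \<and> d \<le> c \<and> a \<le> c \<and> b + d \<le> a + c \<and>
    \<bar>b * c - a * d\<bar> = 1 \<and> a + c \<ge> real (length w) \<and> (\<forall>t\<ge>0. cf_branch w t = (a + b * t) / (c + d * t))"
    using assms
  proof (induction w)
    case Nil
    show ?case by (intro exI[of _ 0] exI[of _ 1]) auto
  next
    case (Cons k w)
    then obtain a b c d :: real where *: "a \<ge> 0" "b \<ge> 0" "c \<ge> 1" "0 \<le> d" "d \<le> c" "a \<le> c" "b + d \<le> a + c"
      "\<bar>b * c - a * d\<bar> = 1" "a + c \<ge> real (length w)"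
      "\<And>t. t \<ge> 0 \<Longrightarrow> cf_branch w t = (a + b * t) / (c + d * t)"
      by auto
    have k: "real k \<ge> 1" using Cons.prems by simp
    define P Q where "P = real k * c" and "Q = real k * d"
    have "P - Q = real k * (c - d)" by (simp add: P_def Q_def right_diff_distrib)
    moreover have "1 * (c - d) \<le> real k * (c - d)" "1 * c \<le> P" "1 * d \<le> Q"
      unfolding P_def Q_def by (intro mult_right_mono k; use * in simp)+
    ultimately have PQ: "c - d \<le> P - Q" "c \<le> P" "d \<le> Q" by simp_all
    have "c \<ge> 0" "d \<ge> 0" "P + a \<ge> 1" "0 \<le> Q + b" "Q + b \<le> P + a"
      "c \<le> P + a" "d + (Q + b) \<le> c + (P + a)" "c + (P + a) \<ge> real (length (k # w))"
      using *(1-7,9) PQ by simp_all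
    note this[unfolded P_def Q_def]
    moreover have "\<bar>d * (real k * c + a) - c * (real k * d + b)\<bar> = 1"
    proof -
      have "d * (real k * c + a) - c * (real k * d + b) = - (b * c - a * d)" by (simp add: algebra_simps)
      then show ?thesis using *(8) by simp
    qed
    moreover have "cf_branch (k # w) t = (c + d * t) / ((real k * c + a) + (real k * d + b) * t)" if "t \<ge> 0" for t
    proof -
      have "c + d * t > 0" using *(3,4) that by (simp add: add_pos_nonneg)
      then have "real k + (a + b * t) / (c + d * t) = ((real k * c + a) + (real k * d + b) * t) / (c + d * t)"
        by (simp add: field_simps)
      then show ?thesis using *(10)[OF that] by simp
    qed
    ultimately show ?case by blast
  qed
  then obtain a b c d :: real where *: "c \<ge> 1" "0 \<le> d" "d \<le> c" "a \<le> c"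
      "\<bar>b * c - a * d\<bar> = 1" "a + c \<ge> real (length w)"
      "\<And>t. t \<ge> 0 \<Longrightarrow> cf_branch w t = (a + b * t) / (c + d * t)" by blast
  \<comment> \<open>The induction bounds a + c because this sum grows by at least 1 with every
    letter; \<open>a \<le> c\<close> converts the bound into one for 2c.\<close>
  show ?thesis by (rule that[OF *(1-3,5)]) (use * in auto)
qed

lemma measure_image_derivative_bounds:
  fixes g g' :: "real \<Rightarrow> real"
  assumes S: "S \<in> sets borel" "S \<subseteq> {0<..<1}" and gS: "g ` S \<in> sets borel" "g ` S \<subseteq> {0<..<1}"
    and der: "\<And>x. x \<in> S \<Longrightarrow> (g has_field_derivative g' x) (at x within S)"
    and inj: "inj_on g S" and bounds: "\<And>x. x \<in> S \<Longrightarrow> l \<le> \<bar>g' x\<bar> \<and> \<bar>g' x\<bar> \<le> u"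
  shows "l * measure lborel S \<le> measure lborel (g ` S)" "measure lborel (g ` S) \<le> u * measure lborel S"
proof -
  have lm: "A \<in> lmeasurable" if "A \<in> sets borel" "A \<subseteq> {0<..<1}" for A :: "real set"
    using that by (intro bounded_set_imp_lmeasurable bounded_subset[OF _ that(2)]) auto
  have int: "(\<lambda>_. 1::real) absolutely_integrable_on A" if "A \<in> lmeasurable" for A :: "real set"
    using that by (simp add: lmeasurable_iff_integrable_on absolutely_integrable_on_iff_nonneg)
  have ms: "measure lborel A = integral A (\<lambda>_. 1)" if "A \<in> sets borel" "A \<subseteq> {0<..<1}" for A :: "real set"
    using lmeasure_integral[OF lm[OF that]] that by (simp add: measure_completion)
  have L: "S \<in> sets lebesgue" using S by simp
  have *: "(\<lambda>x. \<bar>g' x\<bar> * 1) absolutely_integrable_on S \<and> integral S (\<lambda>x. \<bar>g' x\<bar> * 1) = measure lborel (g ` S)"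
    using has_absolute_integral_change_of_variables_1'[OF L der inj, of "\<lambda>_. 1" "measure lborel (g ` S)"]
      int[OF lm[OF gS]] ms[OF gS] by simp
  have i: "(\<lambda>x. \<bar>g' x\<bar>) integrable_on S" using * set_lebesgue_integral_eq_integral(1) by auto
  have c: "(\<lambda>_. r) integrable_on S" "integral S (\<lambda>_. r) = r * measure lborel S" for r :: real
    using integrable_on_cmult_left[of "\<lambda>_. 1::real" S r] integral_mult_right[of S r "\<lambda>_. 1"]
      lm[OF S] ms[OF S] by (simp_all add: lmeasurable_iff_integrable_on)
  show "l * measure lborel S \<le> measure lborel (g ` S)"
    using integral_le[OF c(1) i, of l] bounds * c(2) by auto
  show "measure lborel (g ` S) \<le> u * measure lborel S"
    using integral_le[OF i c(1), of u] bounds * c(2) by auto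
qed

text \<open>Partial quotients are integer parts, since the remainders lie strictly between 0 and 1,
  and can be compared one after the other. Hence cylinders that meet are nested.\<close>

lemma cf_branch_inj:
  assumes "cf_word w" "cf_word v" "length w \<le> length v" "0 < s" "s < 1" "0 < t" "t < 1"
    "cf_branch w s = cf_branch v t"
  shows "w = take (length w) v"
  using assms
proof (induction w arbitrary: v)
  case (Cons k w)
  then obtain l v' where v: "v = l # v'" by (cases v) auto
  have b: "0 < cf_branch w s" "cf_branch w s < 1" "0 < cf_branch v' t" "cf_branch v' t < 1"
    using Cons.prems cf_branch_bounds[of w s] cf_branch_bounds[of v' t] v by auto
  have eq: "real k + cf_branch w s = real l + cf_branch v' t"
    using Cons.prems v by simp
  then have "\<bar>real k - real l\<bar> < 1" using b by linarith
  then have kl: "k = l" by linarith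
  then show ?case using Cons.IH[of v'] Cons.prems eq v by simp
qed simp

lemma inj_on_cf_branch: "cf_word w \<Longrightarrow> inj_on (cf_branch w) {0<..<1}"
proof (induction w)
  case (Cons k w)
  show ?case
  proof (rule inj_onI)
    fix s t assume st: "s \<in> {0<..<1}" "t \<in> {0<..<1}" "cf_branch (k # w) s = cf_branch (k # w) t"
    then have "cf_branch w s = cf_branch w t" by simp
    then show "s = t" using Cons st by (auto dest: inj_onD)
  qed
qed (simp add: inj_on_def)

section \<open>Cylinders of the continued fraction and their distortion\<close>

definition cylinder :: "nat list \<Rightarrow> real set" where
  "cylinder w = cf_branch w ` {0<..<1}"

text \<open>Irrationality keeps every remainder 1/x - k away from 0, so the expansion never
  stops.\<close>

lemma ex_cylinder:
  assumes "x \<notin> \<rat>" "0 < x" "x < 1"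
  shows "\<exists>w. cf_word w \<and> length w = n \<and> x \<in> cylinder w"
proof -
  have "\<exists>w t. cf_word w \<and> length w = n \<and> t \<notin> \<rat> \<and> 0 < t \<and> t < 1 \<and> x = cf_branch w t"
    using assms
  proof (induction n arbitrary: x)
    case 0
    then show ?case by (intro exI[of _ "[]"] exI[of _ x]) auto
  next
    case (Suc n)
    define k where "k = nat \<lfloor>1 / x\<rfloor>"
    define y where "y = 1 / x - real k"
    have "1 / x > 1" using Suc.prems by simp
    then have k: "k \<ge> 1" "real k = of_int \<lfloor>1 / x\<rfloor>" unfolding k_def by linarith+
    have y: "y \<notin> \<rat>"
    proof
      assume "y \<in> \<rat>"
      then have "1 / (y + real k) \<in> \<rat>" by (intro Rats_divide Rats_add Rats_1 Rats_of_nat)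
      then show False using Suc.prems by (simp add: y_def)
    qed
    have "0 \<le> y" "y < 1" unfolding y_def k(2) by linarith+
    moreover have "y \<noteq> 0" using y by auto
    ultimately have "0 < y" "y < 1" by auto
    with Suc.IH[OF y] obtain w t where w: "cf_word w" "length w = n" "t \<notin> \<rat>" "0 < t" "t < 1" "y = cf_branch w t"
      by blast
    have "x = 1 / (real k + y)" using Suc.prems by (simp add: y_def)
    then show ?case using w k by (intro exI[of _ "k # w"] exI[of _ t]) auto
  qed
  then show ?thesis by (auto simp: cylinder_def)
qed

text \<open>The derivative of the branch has modulus 1/(c + d t)^2, which lies between 1/(4 c^2) and
  1/c^2 because 0 \<le> d \<le> c. The ratio of these bounds is the constant 4 in the first claim.
  The last claim combines the upper bound with \<open>2 * c \<ge> real (length w)\<close>.\<close>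

lemma cylinder_measurable_bounds:
  assumes "cf_word w" and B: "B \<in> sets borel" "B \<subseteq> {0<..<1}"
    and img: "cf_branch w ` B \<in> sets borel" "cylinder w \<in> sets borel"
  shows "measure lborel B / 4 * measure lborel (cylinder w) \<le> measure lborel (cf_branch w ` B)"
    and "measure lborel B > 0 \<Longrightarrow> measure lborel (cf_branch w ` B) > 0"
    and "x \<in> cylinder w \<Longrightarrow> y \<in> cylinder w \<Longrightarrow> \<bar>x - y\<bar> \<le> 4 / (real (length w))\<^sup>2 \<or> w = []"
proof -
  obtain a b c d :: real where *: "c \<ge> 1" "0 \<le> d" "d \<le> c" "\<bar>b * c - a * d\<bar> = 1" "2 * c \<ge> real (length w)"
    "\<And>t. 0 \<le> t \<Longrightarrow> cf_branch w t = (a + b * t) / (c + d * t)"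
    by (rule cf_branch_mobius[OF assms(1)]) blast
  have pos: "c \<le> c + d * t" "c + d * t > 0" "c + d * t \<le> 2 * c" if "0 < t" "t < 1" for t
  proof -
    have "0 \<le> d * t" "d * t \<le> c * 1" using that * mult_mono[of d c t 1] by auto
    then show "c \<le> c + d * t" "c + d * t > 0" "c + d * t \<le> 2 * c" using *(1) by auto
  qed
  define g' where "g' t = (b * c - a * d) / (c + d * t)\<^sup>2" for t
  have der: "(cf_branch w has_field_derivative g' t) (at t within S)" if "t \<in> S" "S \<subseteq> {0<..<1}" for t S
  proof -
    have t: "0 < t" "t < 1" using that by auto
    have "((\<lambda>t. (a + b * t) / (c + d * t)) has_field_derivative g' t) (at t within S)"
      unfolding g'_def using pos(2)[OF t]
      by (auto intro!: derivative_eq_intros simp: power2_eq_square field_simps)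
    moreover have "\<And>s. s \<in> S \<Longrightarrow> (a + b * s) / (c + d * s) = cf_branch w s"
      using *(6) that(2) by (metis greaterThanLessThan_iff less_imp_le subsetD)
    ultimately show ?thesis
      using has_field_derivative_transform_within[OF _ zero_less_one that(1)] by blast
  qed
  have bd: "1 / (4 * c\<^sup>2) \<le> \<bar>g' t\<bar>" "\<bar>g' t\<bar> \<le> 1 / c\<^sup>2" if "t \<in> {0<..<1}" for t
  proof -
    have t: "0 < t" "t < 1" using that by auto
    have "\<bar>g' t\<bar> = 1 / (c + d * t)\<^sup>2" using *(4) by (simp add: g'_def)
    moreover have "(c + d * t)\<^sup>2 \<le> (2 * c)\<^sup>2" using pos[OF t] by (intro power_mono) auto
    moreover have "c\<^sup>2 \<le> (c + d * t)\<^sup>2" using pos[OF t] *(1) by (intro power_mono) auto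
    ultimately show "1 / (4 * c\<^sup>2) \<le> \<bar>g' t\<bar>" "\<bar>g' t\<bar> \<le> 1 / c\<^sup>2"
      using pos(2)[OF t] *(1) by (auto simp: power_mult_distrib intro!: divide_left_mono)
  qed
  have sub: "cf_branch w ` S \<subseteq> {0<..<1}" if "S \<subseteq> {0<..<1}" for S
    using cf_branch_bounds[OF assms(1)] that by force
  have lo: "1 / (4 * c\<^sup>2) * measure lborel B \<le> measure lborel (cf_branch w ` B)"
    by (rule measure_image_derivative_bounds(1)[where u = "1 / c\<^sup>2", OF B img(1) sub[OF B(2)] der])
      (use B bd inj_on_subset[OF inj_on_cf_branch[OF assms(1)]] in auto)
  have up: "measure lborel (cylinder w) \<le> 1 / c\<^sup>2 * measure lborel {0<..<1::real}"
    unfolding cylinder_def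
    by (rule measure_image_derivative_bounds(2)[where l = "1 / (4 * c\<^sup>2)", OF _ _ img(2)[unfolded cylinder_def] sub der])
      (use bd inj_on_cf_branch[OF assms(1)] in auto)
  have "measure lborel B / 4 * measure lborel (cylinder w) \<le> measure lborel B / 4 * (1 / c\<^sup>2)"
    using up by (intro mult_left_mono) auto
  also have "\<dots> = 1 / (4 * c\<^sup>2) * measure lborel B" by simp
  finally show "measure lborel B / 4 * measure lborel (cylinder w) \<le> measure lborel (cf_branch w ` B)"
    using lo by linarith
  show "measure lborel (cf_branch w ` B) > 0" if "measure lborel B > 0"
  proof -
    have "0 < 1 / (4 * c\<^sup>2) * measure lborel B" using that *(1) by simp
    then show ?thesis using lo by linarith
  qed
  show "\<bar>x - y\<bar> \<le> 4 / (real (length w))\<^sup>2 \<or> w = []" if xy: "x \<in> cylinder w" "y \<in> cylinder w"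
  proof (cases "w = []")
    case False
    obtain s t where st: "0 < s" "s < 1" "0 < t" "t < 1" "x = cf_branch w s" "y = cf_branch w t"
      using xy by (auto simp: cylinder_def)
    let ?p = "c + d * s" and ?q = "c + d * t"
    have "x - y = (b * c - a * d) * (s - t) / (?p * ?q)"
    proof -
      have "x = (a + b * s) / ?p" "y = (a + b * t) / ?q" using st *(6) by simp_all
      moreover have "?p \<noteq> 0" "?q \<noteq> 0" using pos(2)[OF st(1,2)] pos(2)[OF st(3,4)] by simp_all
      ultimately have "x - y = ((a + b * s) * ?q - (a + b * t) * ?p) / (?p * ?q)" by (simp add: diff_frac_eq)
      also have "(a + b * s) * ?q - (a + b * t) * ?p = (b * c - a * d) * (s - t)" by (simp add: algebra_simps)
      finally show ?thesis .
    qed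
    then have "\<bar>x - y\<bar> = \<bar>s - t\<bar> / (?p * ?q)"
      using *(4) pos(2)[OF st(1,2)] pos(2)[OF st(3,4)] by (simp add: abs_mult)
    also have "\<dots> \<le> 1 / (c * c)"
      using st *(1) pos[OF st(1,2)] pos[OF st(3,4)] by (intro frac_le mult_mono) auto
    also have "\<dots> = 4 / (2 * c)\<^sup>2" by (simp add: power2_eq_square)
    also have "\<dots> \<le> 4 / (real (length w))\<^sup>2"
      using *(5) False by (intro divide_left_mono power_mono mult_pos_pos) auto
    finally show ?thesis by simp
  qed simp
qed

text \<open>The state component of the extension: the Gauss map strips the outermost partial
  quotient first, so the head of the word acts first.\<close>

fun cf_state :: "(nat \<Rightarrow> 'i \<Rightarrow> 'i) \<Rightarrow> nat list \<Rightarrow> 'i \<Rightarrow> 'i" where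
  "cf_state \<sigma> [] i = i"
| "cf_state \<sigma> (k # w) i = cf_state \<sigma> w (\<sigma> k i)"

lemma open_cylinder:
  assumes "cf_word w"
  shows "open (cylinder w)"
proof -
  obtain a b c d :: real where *: "c \<ge> 1" "0 \<le> d"
    "\<And>t. 0 \<le> t \<Longrightarrow> cf_branch w t = (a + b * t) / (c + d * t)"
    by (rule cf_branch_mobius[OF assms]) blast
  have "continuous_on {0<..<1} (\<lambda>t. (a + b * t) / (c + d * t))"
    using *(1,2) by (intro continuous_intros ballI) (auto simp: add_pos_nonneg less_imp_neq[symmetric])
  then have "continuous_on {0<..<1} (cf_branch w)"
    using *(3) by (subst continuous_on_cong[OF refl, of _ _ "\<lambda>t. (a + b * t) / (c + d * t)"]) auto
  then show ?thesis unfolding cylinder_def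
    by (intro injective_eq_1d_open_map_UNIV[THEN iffD1, rule_format] invariance_of_domain inj_on_cf_branch assms) auto
qed

text \<open>By bounded distortion (Renyi's condition) an invariant set of positive measure has density bounded below in every
  cylinder, hence (Knopp) its complement is null.\<close>

theorem gauss_extension_zero_one:
  fixes B :: "'i::finite \<Rightarrow> real set"
  assumes meas: "\<And>i. B i \<in> sets borel"
    and inv: "\<And>i k t. k \<ge> 1 \<Longrightarrow> 0 < t \<Longrightarrow> t < 1 \<Longrightarrow> 1 / (real k + t) \<in> B i \<longleftrightarrow> t \<in> B (\<sigma> k i)"
    and conn: "\<And>i j. \<exists>w. cf_word w \<and> cf_state \<sigma> w i = j"
  shows "(\<forall>i. emeasure lborel (B i \<inter> {0<..<1}) = 0) \<or> (\<forall>i. emeasure lborel ({0<..<1} - B i) = 0)"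
proof -
  let ?J = "{0<..<1::real}"
  have invw: "cf_branch w t \<in> B i \<longleftrightarrow> t \<in> B (cf_state \<sigma> w i)" if "cf_word w" "0 < t" "t < 1" for w i t
    using that
  proof (induction w arbitrary: i)
    case (Cons k w)
    then show ?case using inv[of k "cf_branch w t" i] cf_branch_bounds[of w t] by simp
  qed simp
  \<comment> \<open>By invariance, \<open>B i\<close> meets a cylinder in the branch image of the
    set that belongs to the final state. Its density there is thus controlled by distortion
    alone.\<close>
  have img: "cf_branch w ` (B (cf_state \<sigma> w i) \<inter> ?J) = cylinder w \<inter> B i" if "cf_word w" for w i
    using invw[OF that] by (auto simp: cylinder_def)
  have cm: "cylinder w \<in> sets borel" if "cf_word w" for w using open_cylinder[OF that] by simp
  have fin: "emeasure lborel A = ennreal (measure lborel A)" if "A \<in> sets borel" "A \<subseteq> ?J" for A :: "real set"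
  proof -
    have "emeasure lborel A \<le> emeasure lborel ?J" using that by (intro emeasure_mono) auto
    then have "emeasure lborel A \<noteq> \<infinity>" by (auto simp: top_unique)
    then show ?thesis by (simp add: emeasure_eq_ennreal_measure)
  qed
  define m where "m i = measure lborel (B i \<inter> ?J)" for i
  show ?thesis
  proof (cases "\<forall>i. m i = 0")
    case True
    then show ?thesis using fin[of "B _ \<inter> ?J"] meas by (auto simp: m_def)
  next
    case False
    then obtain j where j: "m j > 0" using measure_nonneg[of lborel] by (metis m_def less_eq_real_def)
    \<comment> \<open>Transitivity spreads positive measure from the state j to all states.\<close>
    have mp: "m i > 0" for i
    proof -
      obtain w where w: "cf_word w" "cf_state \<sigma> w i = j" using conn by blast
      have "measure lborel (cf_branch w ` (B j \<inter> ?J)) > 0"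
        by (rule cylinder_measurable_bounds(2)[OF w(1)])
          (use img[OF w(1), of i] w(2) meas cm[OF w(1)] j in \<open>auto simp: m_def\<close>)
      then have "0 < measure lborel (cylinder w \<inter> B i)" using img[OF w(1), of i] w(2) by simp
      also have "\<dots> \<le> measure lborel (B i \<inter> ?J)"
      proof (rule measure_mono_fmeasurable)
        show "cylinder w \<inter> B i \<subseteq> B i \<inter> ?J"
          using cf_branch_bounds[OF w(1)] by (force simp: cylinder_def)
        show "B i \<inter> ?J \<in> fmeasurable lborel"
          using fin[of "B i \<inter> ?J"] meas by (intro fmeasurableI) auto
      qed (use meas cm[OF w(1)] in auto)
      finally show ?thesis by (simp add: m_def)
    qed
    \<comment> \<open>The minimum is positive because there are finitely many states; 4 is the
      distortion constant.\<close>
    define \<gamma> where "\<gamma> = Min (range m) / 4"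
    have \<gamma>: "\<gamma> > 0" using mp by (simp add: \<gamma>_def)
    have low: "ennreal \<gamma> * emeasure lborel (cylinder w) \<le> emeasure lborel (cylinder w \<inter> B i)" if w: "cf_word w" for w i
    proof -
      have cJ: "cylinder w \<subseteq> ?J" using cf_branch_bounds[OF w] by (force simp: cylinder_def)
      have "\<gamma> * measure lborel (cylinder w) \<le> m (cf_state \<sigma> w i) / 4 * measure lborel (cylinder w)"
        unfolding \<gamma>_def by (intro mult_right_mono divide_right_mono) auto
      also have "\<dots> \<le> measure lborel (cf_branch w ` (B (cf_state \<sigma> w i) \<inter> ?J))"
        unfolding m_def by (rule cylinder_measurable_bounds(1)[OF w]) (use img[OF w] meas cm[OF w] in auto)
      finally have "\<gamma> * measure lborel (cylinder w) \<le> measure lborel (cylinder w \<inter> B i)"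
        unfolding img[OF w] .
      moreover have "cylinder w \<inter> B i \<in> sets borel" "cylinder w \<inter> B i \<subseteq> ?J" using cm[OF w] meas cJ by auto
      ultimately show ?thesis
        using \<gamma> by (simp add: fin cm[OF w] cJ ennreal_mult[symmetric] ennreal_leI)
    qed
    have "emeasure lborel (?J - B i) = 0" for i
    proof -
      define A where "A = ?J - B i"
      have A: "A \<in> sets borel" using meas by (simp add: A_def)
      have main: "ennreal \<gamma> * emeasure lborel A \<le> 0 + ennreal \<delta>" if \<delta>: "\<delta> > 0" for \<delta>
      proof -
        obtain U where U: "open U" "A \<subseteq> U" "emeasure lborel (U - A) < ennreal \<delta>"
          using outer_regular_lborel[OF A \<delta>] by blast
        \<comment> \<open>The words of minimal length whose cylinders lie in U. Their cylinders are
          the maximal ones inside U, hence pairwise disjoint, and they cover all irrational points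
          of A.\<close>
        define W where "W = {w. cf_word w \<and> cylinder w \<subseteq> U \<and> (\<forall>n<length w. \<not> cylinder (take n w) \<subseteq> U)}"
        have disj: "disjoint_family_on cylinder W"
          unfolding disjoint_family_on_def
        proof (intro ballI impI)
          have *: "cylinder w \<inter> cylinder v = {}" if wv: "w \<in> W" "v \<in> W" "w \<noteq> v" "length w \<le> length v" for w v
          proof (rule ccontr)
            assume "cylinder w \<inter> cylinder v \<noteq> {}"
            then obtain s t where "0 < s" "s < 1" "0 < t" "t < 1" "cf_branch w s = cf_branch v t"
              by (auto simp: cylinder_def)
            then have w: "w = take (length w) v"
              using wv by (intro cf_branch_inj) (auto simp: W_def)
            then have "length w < length v" using wv by (metis le_neq_implies_less take_all_iff)
            then have "\<not> cylinder (take (length w) v) \<subseteq> U" using wv(2) by (simp add: W_def)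
            then show False using w wv(1) by (simp add: W_def)
          qed
          show "cylinder w \<inter> cylinder v = {}" if "w \<in> W" "v \<in> W" "w \<noteq> v" for w v
            using *[of w v] *[of v w] that by (metis Int_commute nle_le)
        qed
        have cov: "A - \<rat> \<subseteq> (\<Union>w\<in>W. cylinder w)"
        proof
          fix x assume x: "x \<in> A - \<rat>"
          then have "x \<in> U" using U by auto
          then obtain e where e: "e > 0" "\<And>y. \<bar>y - x\<bar> < e \<Longrightarrow> y \<in> U"
            using U(1) unfolding open_dist dist_real_def by blast
          obtain n :: nat where n: "4 / e < real n" using reals_Archimedean2 by blast
          then have n0: "n > 0" using e(1) by (metis divide_pos_pos gr0I of_nat_0 order_less_asym zero_less_numeral)
          obtain w where w: "cf_word w" "length w = n" "x \<in> cylinder w"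
            using ex_cylinder[of x n] x by (auto simp: A_def)
          have "cylinder w \<subseteq> U"
          proof
            fix y assume y: "y \<in> cylinder w"
            have "w \<noteq> []" using w n0 by auto
            \<comment> \<open>Cylinders of n letters have diameter at most 4/n^2 \<le> 4/n < e. The
              diameter bound does not involve the set B of the lemma, which is therefore taken
              empty.\<close>
            then have "\<bar>y - x\<bar> \<le> 4 / (real n)\<^sup>2"
              using cylinder_measurable_bounds(3)[OF w(1) _ _ _ cm[OF w(1)] y w(3), of "{}"] w(2) by auto
            also have "\<dots> \<le> 4 / real n" using n0 by (auto simp: power2_eq_square field_simps)
            also have "\<dots> < e" using n n0 e(1) by (simp add: field_simps)
            finally show "y \<in> U" by (rule e(2))
          qed
          then have ex: "cylinder (take n w) \<subseteq> U" using w(2) by simp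
          \<comment> \<open>Cutting the word at the first prefix whose cylinder lies in U gives the
            member of W that contains x.\<close>
          define l where "l = (LEAST l. cylinder (take l w) \<subseteq> U)"
          have l: "cylinder (take l w) \<subseteq> U" unfolding l_def by (rule LeastI[of "\<lambda>l. cylinder (take l w) \<subseteq> U", OF ex])
          have ln: "l \<le> n" unfolding l_def by (rule Least_le[of "\<lambda>l. cylinder (take l w) \<subseteq> U", OF ex])
          have "\<not> cylinder (take k w) \<subseteq> U" if "k < l" for k
            using not_less_Least[of k "\<lambda>l. cylinder (take l w) \<subseteq> U"] that by (simp add: l_def)
          moreover have "cf_word (take l w)" using w(1) by (auto dest: in_set_takeD)
          ultimately have "take l w \<in> W" using l ln w(2) by (auto simp: W_def min_def)
          moreover have "x \<in> cylinder (take l w)"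
          proof -
            obtain t where t: "0 < t" "t < 1" "x = cf_branch w t" using w(3) by (auto simp: cylinder_def)
            have app: "cf_branch (u @ v) t = cf_branch u (cf_branch v t)" for u v
              by (induction u) auto
            have "cf_word (drop l w)" using w(1) by (auto dest: in_set_dropD)
            then have "0 < cf_branch (drop l w) t \<and> cf_branch (drop l w) t < 1" using t by (intro cf_branch_bounds)
            moreover have "x = cf_branch (take l w) (cf_branch (drop l w) t)"
              using app[of "take l w" "drop l w"] t(3) by simp
            ultimately show ?thesis by (auto simp: cylinder_def)
          qed
          ultimately show "x \<in> (\<Union>w\<in>W. cylinder w)" by blast
        qed
        have W: "cf_word w" "cylinder w \<subseteq> U" "cylinder w \<subseteq> ?J" if "w \<in> W" for w
          using that cf_branch_bounds[of w] by (force simp: W_def cylinder_def)+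
        have cnt: "countable W" by (rule countableI_type)
        have ns: "\<rat> \<in> null_sets (lborel :: real measure)" by (rule countable_imp_null_set_lborel[OF countable_rat])
        have "emeasure lborel A = emeasure lborel (A - \<rat>)"
          using A ns by (simp add: emeasure_Diff_null_set)
        also have "\<dots> \<le> emeasure lborel (\<Union>w\<in>W. cylinder w)"
          using cov W cm cnt by (intro emeasure_mono) auto
        also have "\<dots> = (\<integral>\<^sup>+ w. emeasure lborel (cylinder w) \<partial>count_space W)"
          using W cm cnt disj by (intro emeasure_UN_countable) auto
        finally have "ennreal \<gamma> * emeasure lborel A \<le> ennreal \<gamma> * (\<integral>\<^sup>+ w. emeasure lborel (cylinder w) \<partial>count_space W)"
          by (intro mult_left_mono) auto
        also have "\<dots> = (\<integral>\<^sup>+ w. ennreal \<gamma> * emeasure lborel (cylinder w) \<partial>count_space W)"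
          by (rule nn_integral_cmult[symmetric]) simp
        also have "\<dots> \<le> (\<integral>\<^sup>+ w. emeasure lborel (cylinder w \<inter> B i) \<partial>count_space W)"
          using low W by (intro nn_integral_mono) auto
        also have "\<dots> = emeasure lborel (\<Union>w\<in>W. cylinder w \<inter> B i)"
        proof (rule emeasure_UN_countable[symmetric])
          show "disjoint_family_on (\<lambda>w. cylinder w \<inter> B i) W"
            using disj unfolding disjoint_family_on_def by blast
        qed (use W cm cnt meas in auto)
        \<comment> \<open>A is the complement of \<open>B i\<close>, so the parts of the cylinders
          inside \<open>B i\<close> lie in the small set U - A.\<close>
        also have "\<dots> \<le> emeasure lborel (U - A)"
          using W U(1) A by (intro emeasure_mono) (auto simp: A_def)
        also have "\<dots> \<le> ennreal \<delta>" using U(3) by simp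
        finally show ?thesis by simp
      qed
      have "ennreal \<gamma> * emeasure lborel A \<le> 0" by (rule ennreal_le_epsilon) (use main in auto)
      then show ?thesis using \<gamma> by (auto simp: A_def)
    qed
    then show ?thesis by blast
  qed
qed

section \<open>Measurable dependence on the parameter\<close>

text \<open>A non-returning point outside F stays one for nearby parameters, but it may fail to be
  generic for them, since the lattice changes with \<theta>. It is therefore replaced by a nearby
  point that is generic for the new parameter.\<close>

lemma open_nonper_escape:
  fixes F :: "point set"
  assumes "closed F"
  shows "open {\<theta>. 0 < \<theta> \<and> \<not> nonper (\<theta>, \<epsilon>) n \<subseteq> F}"
  unfolding open_contains_ball
proof (intro ballI)
  fix \<theta> assume "\<theta> \<in> {\<theta>. 0 < \<theta> \<and> \<not> nonper (\<theta>, \<epsilon>) n \<subseteq> F}"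
  then obtain z where \<theta>: "0 < \<theta>" and z: "z \<in> nonper (\<theta>, \<epsilon>) n" "z \<notin> F" by blast
  have np: "\<forall>q\<in>{1..n}. (mapT (\<theta>, \<epsilon>) ^^ q) z \<noteq> z" using z by (simp add: nonper_def)
  have "z \<in> regularX (\<theta>, \<epsilon>)" using z generic_regular[OF \<theta>] by (auto simp: nonper_def)
  from eventually_nonper[OF this \<theta> np]
  have ev: "eventually (\<lambda>p. 0 < fst (snd p) \<and> fst (snd p) < 1 + fst p \<and> 0 < snd (snd p) \<and> snd (snd p) < 1
    \<and> (\<forall>q\<in>{1..n}. (mapT (fst p, \<epsilon>) ^^ q) (snd p) \<noteq> snd p)) (nhds (\<theta>, z))" .
  have "eventually (\<lambda>p. p \<in> {0<..} \<times> (- F)) (nhds (\<theta>, z))"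
    using assms \<theta> z(2) by (intro eventually_nhds_in_open open_Times) auto
  from eventually_conj[OF this ev] obtain S where S: "open S" "(\<theta>, z) \<in> S"
    "\<And>p. p \<in> S \<Longrightarrow> p \<in> {0<..} \<times> (- F) \<and> 0 < fst (snd p) \<and> fst (snd p) < 1 + fst p \<and> 0 < snd (snd p) \<and> snd (snd p) < 1
    \<and> (\<forall>q\<in>{1..n}. (mapT (fst p, \<epsilon>) ^^ q) (snd p) \<noteq> snd p)"
    unfolding eventually_nhds by auto
  obtain A V where AV: "open A" "open V" "(\<theta>, z) \<in> A \<times> V" "A \<times> V \<subseteq> S"
    by (rule open_prod_elim[OF S(1,2)])
  have "A \<subseteq> {\<theta>. 0 < \<theta> \<and> \<not> nonper (\<theta>, \<epsilon>) n \<subseteq> F}"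
  proof
    fix t assume t: "t \<in> A"
    have z': "z \<in> V" using AV(3) by simp
    then have "(t, z) \<in> S" using t AV(4) by blast
    from S(3)[OF this] have zb: "0 < t" "0 < fst z" "fst z < 1 + t" "0 < snd z" "snd z < 1" by simp_all
    obtain w where w: "w \<in> V" "w \<in> generic t"
      by (rule generic_dense[OF zb(2-5) AV(2) z'])
    then have "(t, w) \<in> S" using t AV(4) by blast
    from S(3)[OF this] have "w \<in> nonper (t, \<epsilon>) n" "w \<notin> F" using w(2) by (simp_all add: nonper_def)
    then show "t \<in> {\<theta>. 0 < \<theta> \<and> \<not> nonper (\<theta>, \<epsilon>) n \<subseteq> F}" using zb(1) by auto
  qed
  moreover have "\<theta> \<in> A" using AV(3) by simp
  ultimately show "\<exists>e>0. ball \<theta> e \<subseteq> {\<theta>. 0 < \<theta> \<and> \<not> nonper (\<theta>, \<epsilon>) n \<subseteq> F}"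
    using AV(1) unfolding open_contains_ball by (meson order_trans)
qed

lemma compact_aperiodicK: 
  assumes "\<theta> > 0"
  shows "compact (aperiodicK (\<theta>, \<epsilon>))"
proof -
  have "compact (\<Inter>(range (\<lambda>n. closure (nonper (\<theta>, \<epsilon>) n))))"
    by (rule compact_Inter) (auto simp: bounded_nonper)
  then show ?thesis by (simp add: aperiodicK_eq assms)
qed

text \<open>The compact sets \<open>closure (nonper (\<theta>, \<epsilon>) n) - U\<close> decrease
  to the empty set, so one of them is already empty.\<close>

lemma aperiodicK_subset_open:
  assumes "\<theta> > 0" "open U" "aperiodicK (\<theta>, \<epsilon>) \<subseteq> U"
  obtains n where "nonper (\<theta>, \<epsilon>) n \<subseteq> U"
proof -
  let ?C = "\<lambda>n. closure (nonper (\<theta>, \<epsilon>) n) - U"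
  have "\<exists>n. ?C n = {}"
  proof (rule ccontr)
    assume ne: "\<nexists>n. ?C n = {}"
    have "\<Inter>(range ?C) \<noteq> {}"
    proof (rule compact_nest)
      show "compact (?C n)" for n using compact_closure_nonper assms(2) by (rule compact_diff)
      show "?C n \<subseteq> ?C m" if "m \<le> n" for m n
        using closure_mono[OF nonper_antimono[OF that]] by blast
    qed (use ne in auto)
    then show False using assms by (auto simp: aperiodicK_eq)
  qed
  then show ?thesis using that closure_subset by blast
qed

text \<open>This form serves measurability: all quantifiers range over countable sets, and for a
  fixed finite union of closed balls the failure of the inclusion is an open condition on \<theta>.
  Open balls come from compactness in one direction, closed balls are used to pass to the closure in
  the other.\<close>

lemma cover_null_aperiodicK_iff:
  assumes "\<theta> > 0" "s > 0"
  shows "cover_null s (aperiodicK (\<theta>, \<epsilon>)) \<longleftrightarrow>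
    (\<forall>m::nat. \<exists>F\<in>{F. finite F \<and> F \<subseteq> rat_balls}. (\<Sum>(c, r)\<in>F. r powr s) < 1 / real (Suc m) \<and>
      (\<exists>n. nonper (\<theta>, \<epsilon>) n \<subseteq> (\<Union>(c, r)\<in>F. cball c r)))" (is "?L \<longleftrightarrow> ?R")
proof
  assume L: ?L
  show ?R
  proof
    fix m :: nat
    have "1 / real (Suc m) > 0" by simp
    from cover_null_compact_balls[OF compact_aperiodicK[OF assms(1)] L assms(2) this]
    obtain F where F: "finite F" "F \<subseteq> rat_balls" "aperiodicK (\<theta>, \<epsilon>) \<subseteq> (\<Union>(c, r)\<in>F. ball c r)"
      "(\<Sum>(c, r)\<in>F. r powr s) < 1 / real (Suc m)" .
    have "open (\<Union>(c, r)\<in>F. ball c r)" by auto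
    from aperiodicK_subset_open[OF assms(1) this F(3)]
    obtain n where "nonper (\<theta>, \<epsilon>) n \<subseteq> (\<Union>(c, r)\<in>F. ball c r)" .
    also have "\<dots> \<subseteq> (\<Union>(c, r)\<in>F. cball c r)" by fastforce
    finally show "\<exists>F\<in>{F. finite F \<and> F \<subseteq> rat_balls}. (\<Sum>(c, r)\<in>F. r powr s) < 1 / real (Suc m) \<and>
      (\<exists>n. nonper (\<theta>, \<epsilon>) n \<subseteq> (\<Union>(c, r)\<in>F. cball c r))" using F by blast
  qed
next
  assume R: ?R
  show ?L
  proof (rule cover_null_cballs[OF assms(2)])
    fix \<eta> :: real assume "\<eta> > 0"
    then obtain m where m: "1 / real (Suc m) < \<eta>" using nat_approx_posE by blast
    from R[rule_format, of m] obtain F where F0: "F \<in> {F. finite F \<and> F \<subseteq> rat_balls}"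
      and F1: "(\<Sum>(c, r)\<in>F. r powr s) < 1 / real (Suc m) \<and> (\<exists>n. nonper (\<theta>, \<epsilon>) n \<subseteq> (\<Union>(c, r)\<in>F. cball c r))"
      by (rule bexE)
    from F1 obtain n where n: "nonper (\<theta>, \<epsilon>) n \<subseteq> (\<Union>(c, r)\<in>F. cball c r)" by (elim conjE exE)
    have F: "finite F" "F \<subseteq> rat_balls" "(\<Sum>(c, r)\<in>F. r powr s) < 1 / real (Suc m)"
      using F0 F1 by simp_all
    have "closed (\<Union>(c, r)\<in>F. cball c r)" using F(1) by (auto intro!: closed_UN)
    with n have "closure (nonper (\<theta>, \<epsilon>) n) \<subseteq> (\<Union>(c, r)\<in>F. cball c r)" by (rule closure_minimal)
    then have "aperiodicK (\<theta>, \<epsilon>) \<subseteq> (\<Union>(c, r)\<in>F. cball c r)"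
      by (auto simp: aperiodicK_eq[OF assms(1)])
    then show "\<exists>F. finite F \<and> F \<subseteq> rat_balls \<and> aperiodicK (\<theta>, \<epsilon>) \<subseteq> (\<Union>(c, r)\<in>F. cball c r) \<and>
      (\<Sum>(c, r)\<in>F. r powr s) < \<eta>" using F(1-3) m by (intro exI[of _ F]) auto
  qed
qed

lemma borel_cover_null_aperiodicK:
  assumes "s > 0"
  shows "{\<theta>. 0 < \<theta> \<and> cover_null s (aperiodicK (\<theta>, \<epsilon>))} \<in> sets borel"
proof -
  let ?\<F> = "{F. finite F \<and> F \<subseteq> rat_balls}"
  let ?E = "\<lambda>F n. {\<theta>. 0 < \<theta> \<and> \<not> nonper (\<theta>, \<epsilon>) n \<subseteq> (\<Union>(c, r)\<in>F. cball c r)}"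
  have cnt: "countable ?\<F>" by (rule countable_Collect_finite_subset[OF countable_rat_balls])
  have b: "?E F n \<in> sets borel" if "finite F" for F n
    using that by (intro borel_open open_nonper_escape closed_UN) auto
  have "{\<theta>. 0 < \<theta> \<and> cover_null s (aperiodicK (\<theta>, \<epsilon>))} =
    (\<Inter>m. \<Union>F\<in>{F\<in>?\<F>. (\<Sum>(c, r)\<in>F. r powr s) < 1 / real (Suc m)}. \<Union>n. {0<..} - ?E F n)" (is "?A = ?B")
  proof (intro set_eqI iffI)
    fix \<theta> assume "\<theta> \<in> ?A"
    then have "\<theta> > 0" "cover_null s (aperiodicK (\<theta>, \<epsilon>))" by auto
    then show "\<theta> \<in> ?B" unfolding cover_null_aperiodicK_iff[OF \<open>\<theta> > 0\<close> assms] by fastforce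
  next
    fix \<theta> assume B: "\<theta> \<in> ?B"
    then have "\<theta> > 0" by auto
    then show "\<theta> \<in> ?A" using B by (auto simp: cover_null_aperiodicK_iff[OF _ assms])
  qed
  also have "\<dots> \<in> sets borel"
  proof (intro sets.countable_INT'' sets.countable_UN'')
    show "countable {F\<in>?\<F>. (\<Sum>(c, r)\<in>F. r powr s) < 1 / real (Suc m)}" for m
      by (rule countable_subset[OF _ cnt]) blast
    show "{0<..} - ?E F n \<in> sets borel" if "F \<in> {F\<in>?\<F>. (\<Sum>(c, r)\<in>F. r powr s) < 1 / real (Suc m)}" for F n m
      using that b[of F n] by (intro sets.Diff) auto
  qed auto
  finally show ?thesis .
qed

section \<open>The renormalization is an extension of the Gauss map\<close>

text \<open>Signs are encoded by \<open>bool\<close> so that the states of the extension form a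
  finite type.\<close>

definition sign_of :: "bool \<Rightarrow> int" where
  "sign_of e = (if e then 1 else -1)"

lemma uminus_sign_of: "- sign_of e = sign_of (\<not> e)"
  by (simp add: sign_of_def)

text \<open>Each unit removed reverses the sign: an even n keeps e, an odd n negates it.\<close>

lemma cover_null_renorm_subtract_nat:
  assumes "0 < t" "t < 1" "s > 0"
  shows "cover_null s (aperiodicK (real n + t, sign_of e)) \<longleftrightarrow>
    cover_null s (aperiodicK (t, sign_of (even n = e)))"
proof (induction n arbitrary: e)
  case (Suc n)
  have "real (Suc n) + t > 1" using assms by simp
  then have "cover_null s (aperiodicK (real (Suc n) + t, sign_of e)) \<longleftrightarrow>
      cover_null s (aperiodicK (real (Suc n) + t - 1, - sign_of e))"
    using assms by (intro cover_null_renorm_subtract) (auto simp: sign_of_def)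
  also have "real (Suc n) + t - 1 = real n + t" by simp
  finally have "cover_null s (aperiodicK (real (Suc n) + t, sign_of e)) \<longleftrightarrow>
      cover_null s (aperiodicK (real n + t, - sign_of e))" .
  moreover have "(even n = (\<not> e)) = (even (Suc n) = e)" by auto
  ultimately show ?case unfolding uminus_sign_of Suc.IH by (simp only:)
qed simp

text \<open>In the coordinate 1/\<theta> the renormalization of the sign 1 is subtraction of 1. All
  parameters are below 1 until the integer part is used up, and the last step ends at 1/t >
  1.\<close>

lemma cover_null_renorm_reflection_nat:
  assumes "0 < t" "t < 1" "s > 0"
  shows "cover_null s (aperiodicK (1 / (real n + t), 1)) \<longleftrightarrow> cover_null s (aperiodicK (1 / t, 1))"
proof (induction n)
  case (Suc n)
  let ?\<theta> = "1 / (real (Suc n) + t)"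
  have "cover_null s (aperiodicK (?\<theta>, 1)) \<longleftrightarrow> cover_null s (aperiodicK (?\<theta> / (1 - ?\<theta>), 1))"
    using assms by (intro cover_null_renorm_reflection) auto
  also have "?\<theta> / (1 - ?\<theta>) = 1 / (real n + t)" using assms by (simp add: field_simps)
  finally show ?case using Suc.IH by simp
qed simp

text \<open>State \<open>Some e\<close> stands for the
  parameter \<open>(\<theta>, sign_of e)\<close>, state \<open>None\<close> for the wide rectangle parameter \<open>(1 / \<theta> - 1, -1)\<close>.\<close>

definition renorm_null :: "real \<Rightarrow> bool option \<Rightarrow> real set" where
  "renorm_null s i = (case i of
     Some e \<Rightarrow> {\<theta>. 0 < \<theta> \<and> cover_null s (aperiodicK (\<theta>, sign_of e))}
   | None \<Rightarrow> {0<..<1} \<inter> {\<theta>. 1 / \<theta> - 1 \<in> {\<theta>. 0 < \<theta> \<and> cover_null s (aperiodicK (\<theta>, -1))}})"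

text \<open>With \<theta> = 1/(k + t): \<open>None\<close> means (k - 1 + t, -1), and k - 1
  subtractions give the sign 1 at t exactly for even k. From (\<theta>, -1) the rotation gives (k -
  1 + t, 1), so the sign at t is 1 exactly for odd k. From (\<theta>, 1) the partial quotient is
  stripped to reach (1/t, 1), and one subtraction gives (1/t - 1, -1), which is \<open>None\<close>
  at t for every k.\<close>

definition renorm_state :: "nat \<Rightarrow> bool option \<Rightarrow> bool option" where
  "renorm_state k i = (case i of None \<Rightarrow> Some (even k) | Some e \<Rightarrow> if e then None else Some (odd k))"

lemma borel_renorm_null: "s > 0 \<Longrightarrow> renorm_null s i \<in> sets borel"
proof (cases i)
  case None
  assume "s > 0"
  have "(\<lambda>\<theta>. 1 / \<theta> - 1) -` {\<theta>. 0 < \<theta> \<and> cover_null s (aperiodicK (\<theta>, -1))} \<inter> space borel \<in> sets (borel :: real measure)"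
    by (rule measurable_sets[OF _ borel_cover_null_aperiodicK[OF \<open>s > 0\<close>]]) measurable
  then show ?thesis unfolding renorm_null_def None by (auto simp: vimage_def)
qed (simp add: renorm_null_def borel_cover_null_aperiodicK)

lemma renorm_null_step:
  assumes "s > 0" "k \<ge> 1" "0 < t" "t < 1"
  shows "1 / (real k + t) \<in> renorm_null s i \<longleftrightarrow> t \<in> renorm_null s (renorm_state k i)"
proof -
  let ?\<theta> = "1 / (real k + t)"
  have \<theta>: "0 < ?\<theta>" "?\<theta> < 1" using inverse_shift_bounds[OF assms(2-4)] .
  have pos: "real (k - 1) + t > 0" using assms by (intro add_nonneg_pos) auto
  have inv\<theta>: "1 / ?\<theta> - 1 = real (k - 1) + t" using assms by (simp add: of_nat_diff)
  have wide: "1 / t - 1 > 0" using assms by (simp add: field_simps)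
  have even: "even (k - 1) \<longleftrightarrow> odd k" using assms(2) by simp
  show ?thesis
  proof (cases i)
    case None
    have "?\<theta> \<in> renorm_null s i \<longleftrightarrow> cover_null s (aperiodicK (real (k - 1) + t, sign_of False))"
      using \<theta> pos unfolding renorm_null_def None inv\<theta>[symmetric] by (auto simp: sign_of_def)
    also have "\<dots> \<longleftrightarrow> cover_null s (aperiodicK (t, sign_of (even k)))"
      unfolding cover_null_renorm_subtract_nat[OF assms(3,4,1)] even by simp
    finally show ?thesis using assms(3) by (simp only: renorm_state_def None option.case) (simp add: renorm_null_def)
  next
    case (Some e)
    show ?thesis
    proof (cases e)
      case True
      have "?\<theta> \<in> renorm_null s i \<longleftrightarrow> cover_null s (aperiodicK (?\<theta>, 1))"
        using \<theta> by (simp add: renorm_null_def Some True sign_of_def)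
      also have "\<dots> \<longleftrightarrow> cover_null s (aperiodicK (1 / t, 1))"
        by (rule cover_null_renorm_reflection_nat[OF assms(3,4,1)])
      also have "\<dots> \<longleftrightarrow> cover_null s (aperiodicK (1 / t - 1, - 1))"
        using wide assms(1) by (intro cover_null_renorm_subtract) auto
      finally show ?thesis using wide assms(3,4) by (simp add: renorm_null_def renorm_state_def Some True)
    next
      case False
      have "?\<theta> \<in> renorm_null s i \<longleftrightarrow> cover_null s (aperiodicK (?\<theta>, -1))"
        using \<theta> by (simp add: renorm_null_def Some False sign_of_def)
      also have "\<dots> \<longleftrightarrow> cover_null s (aperiodicK (real (k - 1) + t, sign_of True))"
        unfolding cover_null_renorm_rotation[OF \<theta> assms(1)] inv\<theta> by (simp add: sign_of_def)
      also have "\<dots> \<longleftrightarrow> cover_null s (aperiodicK (t, sign_of (odd k)))"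
        unfolding cover_null_renorm_subtract_nat[OF assms(3,4,1)] even by simp
      finally show ?thesis using assms(3) by (simp add: renorm_null_def renorm_state_def Some False)
    qed
  qed
qed

text \<open>The partial quotient 1 alone permutes the three states cyclically, so words of length at
  most 2 suffice.\<close>

lemma renorm_state_transitive: "\<exists>w. cf_word w \<and> cf_state renorm_state w i = j"
proof -
  have "renorm_state 1 (Some False) = Some True" "renorm_state 1 (Some True) = None"
    "renorm_state 1 None = Some False" by (simp_all add: renorm_state_def)
  then have "cf_state renorm_state [] i = j \<or> cf_state renorm_state [1] i = j \<or> cf_state renorm_state [1, 1] i = j"
    by (cases i; cases j) (auto simp: renorm_state_def)
  then show ?thesis
    by (elim disjE) (rule exI[of _ "[]"], simp, rule exI[of _ "[1]"], simp, rule exI[of _ "[1, 1]"], simp)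
qed

lemma cover_null_aperiodicK_zero_one:
  assumes "s > 0"
  shows "(\<forall>e. {\<theta>\<in>{0<..<1}. cover_null s (aperiodicK (\<theta>, sign_of e))} \<in> null_sets lborel) \<or>
    (\<forall>e. {\<theta>\<in>{0<..<1}. \<not> cover_null s (aperiodicK (\<theta>, sign_of e))} \<in> null_sets lborel)"
proof -
  have eq: "renorm_null s (Some e) \<inter> {0<..<1} = {\<theta>\<in>{0<..<1}. cover_null s (aperiodicK (\<theta>, sign_of e))}"
    "{0<..<1} - renorm_null s (Some e) = {\<theta>\<in>{0<..<1}. \<not> cover_null s (aperiodicK (\<theta>, sign_of e))}" for e
    by (auto simp: renorm_null_def)
  have "(\<forall>i. emeasure lborel (renorm_null s i \<inter> {0<..<1}) = 0) \<or>
    (\<forall>i. emeasure lborel ({0<..<1} - renorm_null s i) = 0)"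
    by (rule gauss_extension_zero_one[where \<sigma> = renorm_state])
      (use assms renorm_null_step borel_renorm_null renorm_state_transitive in auto)
  moreover have "renorm_null s i \<inter> {0<..<1} \<in> sets borel" "{0<..<1} - renorm_null s i \<in> sets borel" for i
    using borel_renorm_null[OF assms, of i] by auto
  ultimately have "(\<forall>i. renorm_null s i \<inter> {0<..<1} \<in> null_sets lborel) \<or>
    (\<forall>i. {0<..<1} - renorm_null s i \<in> null_sets lborel)"
    by (simp add: null_sets_def)
  then show ?thesis unfolding eq[symmetric] by blast
qed

lemma cover_null_3_aperiodicK:
  assumes "0 < \<theta>" "\<theta> < 1"
  shows "cover_null 3 (aperiodicK (\<theta>, \<epsilon>))"
proof (rule cover_null_3_square)
  have "nonper (\<theta>, \<epsilon>) 0 \<subseteq> {0..2} \<times> {0..2}"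
    using assms by (auto simp: nonper_def generic_def)
  then have "closure (nonper (\<theta>, \<epsilon>) 0) \<subseteq> {0..2} \<times> {0..2}"
    by (intro closure_minimal closed_Times) auto
  then show "aperiodicK (\<theta>, \<epsilon>) \<subseteq> {0..2} \<times> {0..2}"
    using assms by (auto simp: aperiodicK_eq)
qed

theorem theorem2p10:
  shows "\<exists>s::real. AE \<omega> in Omega_measure. hausdorff_dim (aperiodicK \<omega>) = ereal s"
proof -
  define small where "small s e = {\<theta>\<in>{0<..<1}. cover_null s (aperiodicK (\<theta>, sign_of e))}" for s e
  define large where "large s e = {\<theta>\<in>{0<..<1}. \<not> cover_null s (aperiodicK (\<theta>, sign_of e))}" for s e
  \<comment> \<open>The exponents for which nullity holds for almost every parameter, with both
    signs. The exponent 3 is one of them, so the infimum is taken over a nonempty set.\<close>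
  define S where "S = {s. 0 < s \<and> (\<forall>e. large s e \<in> null_sets lborel)}"
  define d where "d = Inf S"
  have "large 3 e = {}" for e using cover_null_3_aperiodicK by (auto simp: large_def)
  then have S3: "3 \<in> S" by (simp add: S_def)
  have bdd: "bdd_below S" by (rule bdd_belowI[of _ 0]) (simp add: S_def)
  have d0: "0 \<le> d" unfolding d_def
  proof (rule cInf_greatest)
    show "S \<noteq> {}" using S3 by blast
  qed (simp add: S_def)
  have above: "large q e \<in> null_sets lborel" if dq: "d < q" for q e
  proof -
    obtain s where s: "s \<in> S" "s < q"
      using dq S3 cInf_less_iff[OF _ bdd, of q] unfolding d_def by blast
    have "large q e = {0<..<1} - {\<theta>. 0 < \<theta> \<and> cover_null q (aperiodicK (\<theta>, sign_of e))}"
      by (auto simp: large_def)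
    then have "large q e \<in> sets lborel"
      using borel_cover_null_aperiodicK[of q "sign_of e"] dq d0 by simp
    moreover have "large q e \<subseteq> large s e"
      using s cover_null_mono[of s q] by (auto simp: S_def large_def)
    ultimately show ?thesis using s(1) unfolding S_def by (blast intro: null_sets_subset)
  qed
  \<comment> \<open>An exponent outside S violates the second alternative of the zero-one law, which
    leaves the first.\<close>
  have below: "small q e \<in> null_sets lborel" if "0 < q" "q < d" for q e
  proof -
    have "q \<notin> S" using that cInf_lower[OF _ bdd, of q] by (auto simp: d_def)
    then show ?thesis
      using cover_null_aperiodicK_zero_one[OF that(1)] that(1) by (auto simp: S_def small_def large_def)
  qed
  \<comment> \<open>The parameter 0 is added because the zero-one law speaks about the open
    interval; only rational exponents enter, so the unions are countable.\<close>
  define N where "N = {0} \<union> (\<Union>q\<in>\<rat> \<inter> {d<..}. \<Union>e. large q e) \<union> (\<Union>q\<in>\<rat> \<inter> {0<..<d}. \<Union>e. small q e)"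
  have "N \<in> null_sets lborel"
    unfolding N_def using above below
    by (intro null_sets.Un null_sets_UN' countable_Int1 countable_rat) auto
  then have N: "N \<inter> {0..<1} \<in> null_sets (restrict_space lborel {0..<1})"
    by (simp add: null_sets_restrict_space null_set_Int2)
  interpret sigma_finite_measure "count_space {-1, 1::int}"
    by (rule sigma_finite_measure_count_space_finite) simp
  have null: "(N \<inter> {0..<1}) \<times> {-1, 1} \<in> null_sets Omega_measure"
    using N unfolding Omega_measure_def by (intro times_in_null_sets1) auto
  have "hausdorff_dim (aperiodicK \<omega>) = ereal d" if \<omega>: "\<omega> \<in> Omega" "fst \<omega> \<notin> N" for \<omega>
  proof -
    obtain \<theta> \<epsilon> where "\<omega> = (\<theta>, \<epsilon>)" "0 \<le> \<theta>" "\<theta> < 1" "\<epsilon> = -1 \<or> \<epsilon> = 1"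
      using \<omega>(1) by (cases \<omega>) (auto simp: Omega_def)
    moreover define e where "e \<longleftrightarrow> \<epsilon> = 1"
    ultimately have e: "\<omega> = (\<theta>, sign_of e)" "0 \<le> \<theta>" "\<theta> < 1" by (auto simp: sign_of_def)
    have "\<theta> \<noteq> 0" using \<omega>(2) e by (auto simp: N_def)
    then have \<theta>: "\<theta> \<in> {0<..<1}" using e by simp
    show ?thesis unfolding e(1)
    proof (rule hausdorff_dim_eqI[OF d0])
      show "cover_null q (aperiodicK (\<theta>, sign_of e))" if "d < q" "q \<in> \<rat>" for q
        using \<omega>(2) \<theta> that unfolding N_def e(1) large_def by auto
      show "\<not> cover_null q (aperiodicK (\<theta>, sign_of e))" if "0 < q" "q < d" "q \<in> \<rat>" for q
        using \<omega>(2) \<theta> that unfolding N_def e(1) small_def by auto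
    qed
  qed
  then have "{\<omega>\<in>space Omega_measure. hausdorff_dim (aperiodicK \<omega>) \<noteq> ereal d} \<subseteq> {\<omega>\<in>Omega. fst \<omega> \<in> N}"
    unfolding space_Omega_measure by blast
  also have "\<dots> \<subseteq> (N \<inter> {0..<1}) \<times> {-1, 1}" by (auto simp: Omega_def)
  finally have "{\<omega>\<in>space Omega_measure. hausdorff_dim (aperiodicK \<omega>) \<noteq> ereal d} \<subseteq> (N \<inter> {0..<1}) \<times> {-1, 1}" .
  from AE_I'[OF null this] show ?thesis by blast
qed

end
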